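(* Let $n,n'$ be positive integers, let $A=(A_{ij})$ be an $n\times n$ matrix, $B=(B_{i'j'})$ an $n'\times n'$ matrix, $U=(U_{i'j})$ an $n'\times n$ matrix and $V=(V_{ij'})$ an $n\times n'$ matrix. Put $$\widetilde{B}=B+U(I-A)^{-1}V,\qquad (I-A)^{-1}=\sum_{k\ge 0}A^{k}.$$ Then $$\sum_{\mathbf r\in\mathbb{Z}_{\ge 0}^n}\frac{1}{\mathbf r!}\,\mathrm{perm}_{\beta}\begin{bmatrix} B & U(n^{\mathbf r})\\ V(n^{\mathbf r}) & A(n^{\mathbf r},n^{\mathbf r})\end{bmatrix}=\frac{\mathrm{perm}_{\beta}\,\widetilde{B}}{\det(I-A)^{\beta}}.$$
   Context: Extended permanent: for a square matrix $M=(M_{xy})$ indexed by a finite set $X$, $\mathrm{perm}_\beta M=\sum_{\pi\in\Sigma_X}\beta^{C(\pi)}\prod_{x\in X}M_{x\pi(x)}$, where $\Sigma_X$ is the group of permutations of $X$ and $C(\pi)$ is the number of cycles of $\pi$ (fixed points count as cycles of length 1). Multisets: for $\mathbf r=(r_1,\ldots,r_n)\in\mathbb{Z}_{\ge0}^n$ put $\mathbf r!=r_1!\cdots r_n!$, $N=r_1+\cdots+r_n$, and let $n^{\mathbf r}=\{1_1,\ldots,1_{r_1},\ldots,n_1,\ldots,n_{r_n}\}$ be the multiset of size $N$ in which the index $i$ is repeated $r_i$ times; the labelled copies $i_a$ ($1\le a\le r_i$) are treated as $N$ distinct indices. $A(n^{\mathbf r},n^{\mathbf r})$ is the $N\times N$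 matrix indexed by $n^{\mathbf r}$ with $(i_a,j_b)$ entry $A_{ij}$; $U(n^{\mathbf r})$ is the $n'\times N$ matrix with $(i',j_b)$ entry $U_{i'j}$; $V(n^{\mathbf r})$ is the $N\times n'$ matrix with $(i_a,j')$ entry $V_{ij'}$. The block matrix is $(n'+N)\times(n'+N)$, indexed by $\{1',\ldots,n'\}\cup n^{\mathbf r}$; for $\mathbf r=(0,\ldots,0)$ it is just $B$. Interpretation: $\beta$ and the entries of $A,B,U,V$ are commuting indeterminates and the identity is one of formal power series with rational coefficients in them; $\det(I-A)^{-\beta}$ means $\exp\left(\beta\sum_{t\ge1}\frac1t\mathrm{Tr}(A^t)\right)$. $I$ is the identity matrix. *)

theory Defs
  imports "HOL-Analysis.Analysis" "HOL-Library.Poly_Mapping" "HOL-Combinatorics.Orbits"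
begin

section \<open>Formal power series in a family of commuting indeterminates\<close>

text \<open>A formal power series over the rationals in the indeterminates \<open>'v\<close> is an arbitrary
  assignment of coefficients to monomials; a monomial is a finitely supported exponent vector.\<close>

typedef 'v mps = "UNIV :: (('v \<Rightarrow>\<^sub>0 nat) \<Rightarrow> rat) set"
  morphisms coeff Abs_mps ..

setup_lifting type_definition_mps

lemma mps_eqI: "(\<And>m. coeff f m = coeff g m) \<Longrightarrow> f = g"
  by transfer auto

lemma finite_monomial_splittings [simp]:
  "finite {(a, b). a + b = (m :: 'v \<Rightarrow>\<^sub>0 nat)}"
proof -
  let ?S = "{(a, b). a + b = m}"
  let ?F = "{f. \<forall>x. (x \<in> Poly_Mapping.keys m \<longrightarrow> f x \<in> {..Max (insert 0 (Poly_Mapping.lookup m ` Poly_Mapping.keys m))})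
                \<and> (x \<notin> Poly_Mapping.keys m \<longrightarrow> f x = 0)}"
  have le: "Poly_Mapping.lookup p x \<le> Poly_Mapping.lookup m x" if "\<exists>q. p + q = m \<or> q + p = m" for p x
    using that by (auto simp: Poly_Mapping.lookup_add)
  have inF: "Poly_Mapping.lookup p \<in> ?F" if "\<exists>q. p + q = m \<or> q + p = m" for p
  proof (intro CollectI allI conjI impI)
    fix x assume x: "x \<in> Poly_Mapping.keys m"
    have "Poly_Mapping.lookup m x \<le> Max (insert 0 (Poly_Mapping.lookup m ` Poly_Mapping.keys m))"
      by (rule Max_ge) (use x in auto)
    with le[OF that, of x] show "Poly_Mapping.lookup p x \<in> {..Max (insert 0 (Poly_Mapping.lookup m ` Poly_Mapping.keys m))}" by simp
  next
    fix x assume "x \<notin> Poly_Mapping.keys m"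
    with le[OF that, of x] show "Poly_Mapping.lookup p x = 0" by (simp add: in_keys_iff)
  qed
  have fin: "finite ?F" by (rule finite_set_of_finite_funs) auto
  have "map_prod Poly_Mapping.lookup Poly_Mapping.lookup ` ?S \<subseteq> ?F \<times> ?F"
    using inF by fastforce
  then have "finite (map_prod Poly_Mapping.lookup Poly_Mapping.lookup ` ?S)"
    by (rule finite_subset) (intro finite_cartesian_product fin)
  moreover have "inj_on (map_prod Poly_Mapping.lookup Poly_Mapping.lookup) ?S"
    by (auto simp: inj_on_def)
  ultimately show ?thesis by (rule finite_imageD)
qed

instantiation mps :: (type) comm_ring_1
begin

lift_definition zero_mps :: "'v mps" is "\<lambda>_. 0" .
lift_definition one_mps :: "'v mps" is "\<lambda>m. if m = 0 then 1 else 0" .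
lift_definition plus_mps :: "'v mps \<Rightarrow> 'v mps \<Rightarrow> 'v mps" is "\<lambda>f g m. f m + g m" .
lift_definition minus_mps :: "'v mps \<Rightarrow> 'v mps \<Rightarrow> 'v mps" is "\<lambda>f g m. f m - g m" .
lift_definition uminus_mps :: "'v mps \<Rightarrow> 'v mps" is "\<lambda>f m. - f m" .
lift_definition times_mps :: "'v mps \<Rightarrow> 'v mps \<Rightarrow> 'v mps"
  is "\<lambda>f g m. \<Sum>(a, b) | a + b = m. f a * g b" .

instance
proof
  fix f g h :: "'a mps"
  show "f * g * h = f * (g * h)"
  proof (transfer, rule ext)
    fix f g h :: "('a \<Rightarrow>\<^sub>0 nat) \<Rightarrow> rat" and m :: "'a \<Rightarrow>\<^sub>0 nat"
    have "(\<Sum>(a, b) | a + b = m. (\<Sum>(c, d) | c + d = a. f c * g d) * h b) =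
          (\<Sum>p\<in>{(a, b). a + b = m}. \<Sum>q\<in>{(c, d). c + d = fst p}. f (fst q) * g (snd q) * h (snd p))"
      by (simp add: case_prod_unfold sum_distrib_right)
    also have "\<dots> = (\<Sum>x\<in>(SIGMA p:{(a, b). a + b = m}. {(c, d). c + d = fst p}).
                      f (fst (snd x)) * g (snd (snd x)) * h (snd (fst x)))"
      by (subst sum.Sigma) (auto simp: case_prod_unfold finite_monomial_splittings[unfolded case_prod_unfold])
    also have "\<dots> = (\<Sum>x\<in>(SIGMA p:{(a, b). a + b = m}. {(c, d). c + d = snd p}).
                      f (fst (fst x)) * (g (fst (snd x)) * h (snd (snd x))))"
      by (rule sum.reindex_bij_witness
          [where i = "\<lambda>((a, b), (c, d)). ((a + c, d), (a, c))"
             and j = "\<lambda>((a, b), (c, d)). ((c, d + b), (d, b))"]) (auto simp: ac_simps)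
    also have "\<dots> = (\<Sum>p\<in>{(a, b). a + b = m}. \<Sum>q\<in>{(c, d). c + d = snd p}.
                      f (fst p) * (g (fst q) * h (snd q)))"
      by (subst sum.Sigma) (auto simp: case_prod_unfold finite_monomial_splittings[unfolded case_prod_unfold])
    also have "\<dots> = (\<Sum>(a, b) | a + b = m. f a * (\<Sum>(c, d) | c + d = b. g c * h d))"
      by (simp add: case_prod_unfold sum_distrib_left)
    finally show "(\<Sum>(a, b) | a + b = m. (\<Sum>(c, d) | c + d = a. f c * g d) * h b) =
          (\<Sum>(a, b) | a + b = m. f a * (\<Sum>(c, d) | c + d = b. g c * h d))" .
  qed
  show "f * g = g * f"
  proof (transfer, rule ext)
    fix f g :: "('a \<Rightarrow>\<^sub>0 nat) \<Rightarrow> rat" and m :: "'a \<Rightarrow>\<^sub>0 nat"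
    show "(\<Sum>(a, b) | a + b = m. f a * g b) = (\<Sum>(a, b) | a + b = m. g a * f b)"
      by (rule sum.reindex_bij_witness[where i = prod.swap and j = prod.swap])
         (auto simp: ac_simps)
  qed
  show "1 * f = f"
  proof (transfer, rule ext)
    fix f :: "('a \<Rightarrow>\<^sub>0 nat) \<Rightarrow> rat" and m :: "'a \<Rightarrow>\<^sub>0 nat"
    have "(\<Sum>(a, b) | a + b = m. (if a = 0 then 1 else 0) * f b) =
          (\<Sum>(a, b)\<in>{(0 :: 'a \<Rightarrow>\<^sub>0 nat, m)}. f b)"
      by (rule sum.mono_neutral_cong_right) (auto split: if_splits)
    then show "(\<Sum>(a, b) | a + b = m. (if a = 0 then 1 else 0) * f b) = f m" by simp
  qed
  show "(f + g) * h = f * h + g * h"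
    by transfer (auto simp: algebra_simps sum.distrib case_prod_unfold)
  show "(0 :: 'a mps) \<noteq> 1"
    by transfer (auto simp: fun_eq_iff)
qed (transfer; auto simp: algebra_simps)+

end

lift_definition const :: "rat \<Rightarrow> 'v mps" is "\<lambda>c m. if m = 0 then c else 0" .

lift_definition Var :: "'v \<Rightarrow> 'v mps" is "\<lambda>v m. if m = Poly_Mapping.single v 1 then 1 else 0" .

text \<open>The usual topology on formal power series: the product topology with respect to the
  discrete topology on the coefficients. All infinite sums below refer to it.\<close>

instantiation mps :: (type) t2_space
begin

definition open_mps :: "'a mps set \<Rightarrow> bool" where
  "open S \<longleftrightarrow> (\<forall>f\<in>S. \<exists>M. finite M \<and> {g. \<forall>m\<in>M. coeff g m = coeff f m} \<subseteq> S)"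

instance
proof
  show "open (UNIV :: 'a mps set)" by (auto simp: open_mps_def)
next
  fix S T :: "'a mps set" assume "open S" "open T"
  show "open (S \<inter> T)" unfolding open_mps_def
  proof
    fix f assume "f \<in> S \<inter> T"
    then obtain M N where "finite M" "{g. \<forall>m\<in>M. coeff g m = coeff f m} \<subseteq> S"
      "finite N" "{g. \<forall>m\<in>N. coeff g m = coeff f m} \<subseteq> T"
      using \<open>open S\<close> \<open>open T\<close> unfolding open_mps_def by (meson IntE)
    then show "\<exists>M. finite M \<and> {g. \<forall>m\<in>M. coeff g m = coeff f m} \<subseteq> S \<inter> T"
      by (intro exI[of _ "M \<union> N"]) auto
  qed
next
  fix K :: "'a mps set set" assume "\<forall>S\<in>K. open S"
  then show "open (\<Union>K)" unfolding open_mps_def by (meson Union_iff Union_upper order_trans)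
next
  fix f g :: "'a mps" assume "f \<noteq> g"
  then obtain m where m: "coeff f m \<noteq> coeff g m" using mps_eqI by blast
  have *: "open {h :: 'a mps. coeff h m = c}" for c
    unfolding open_mps_def by (auto intro!: exI[of _ "{m}"])
  show "\<exists>U V. open U \<and> open V \<and> f \<in> U \<and> g \<in> V \<and> U \<inter> V = {}"
    by (rule exI[of _ "{h. coeff h m = coeff f m}"], rule exI[of _ "{h. coeff h m = coeff g m}"])
       (use m * in auto)
qed

end

lemma tendsto_mps_iff:
  "(f \<longlongrightarrow> l) F \<longleftrightarrow> (\<forall>m. \<forall>\<^sub>F x in F. coeff (f x) m = coeff l m)"
proof (intro iffI allI)
  fix m assume "(f \<longlongrightarrow> l) F"
  moreover have "open {h. coeff h m = coeff l m}"
    unfolding open_mps_def by (auto intro!: exI[of _ "{m}"])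
  ultimately show "\<forall>\<^sub>F x in F. coeff (f x) m = coeff l m"
    by (auto dest: topological_tendstoD)
next
  assume *: "\<forall>m. \<forall>\<^sub>F x in F. coeff (f x) m = coeff l m"
  show "(f \<longlongrightarrow> l) F"
  proof (rule topological_tendstoI)
    fix S assume "open S" "l \<in> S"
    then obtain M where "finite M" and M: "{g. \<forall>m\<in>M. coeff g m = coeff l m} \<subseteq> S"
      by (auto simp: open_mps_def)
    then have "\<forall>\<^sub>F x in F. \<forall>m\<in>M. coeff (f x) m = coeff l m"
      using * by (simp add: eventually_ball_finite)
    then show "\<forall>\<^sub>F x in F. f x \<in> S"
      by (rule eventually_mono) (use M in auto)
  qed
qed

text \<open>The formal exponential; the defining series converges if \<open>f\<close> has no constant term.\<close>

definition mps_exp :: "'v mps \<Rightarrow> 'v mps" where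
  "mps_exp f = suminf (\<lambda>k. const (1 / fact k) * f ^ k)"


section \<open>The \<open>\<beta>\<close>-extended permanent\<close>

text \<open>\<^const>\<open>orbit\<close> uses at least one application of the permutation, so a fixed point has itself
  as orbit and is counted as a cycle.\<close>

definition num_cycles :: "'x set \<Rightarrow> ('x \<Rightarrow> 'x) \<Rightarrow> nat" where
  "num_cycles X \<pi> = card (orbit \<pi> ` X)"

definition perm :: "'a::comm_semiring_1 \<Rightarrow> 'x set \<Rightarrow> ('x \<Rightarrow> 'x \<Rightarrow> 'a) \<Rightarrow> 'a" where
  "perm \<beta> X M = (\<Sum>\<pi> | \<pi> permutes X. \<beta> ^ num_cycles X \<pi> * (\<Prod>x\<in>X. M x (\<pi> x)))"


section \<open>Matrices\<close>

primrec mat_power :: "'a::semiring_1 ^ 'n ^ 'n \<Rightarrow> nat \<Rightarrow> 'a ^ 'n ^ 'n" where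
  "mat_power A 0 = mat 1"
| "mat_power A (Suc k) = A ** mat_power A k"

text \<open>The two series below converge when the entries of \<open>A\<close> have no constant term, in particular
  when they are indeterminates.\<close>

definition neumann_inverse :: "'v mps ^ 'n ^ 'n \<Rightarrow> 'v mps ^ 'n ^ 'n" where
  "neumann_inverse A = suminf (mat_power A)"

text \<open>\<open>det (I - A)\<close> to the power \<open>-\<beta>\<close>, read as \<open>exp (\<beta> * (\<Sum>t\<ge>1. Tr (A^t) / t))\<close>.\<close>

definition det_id_minus_neg_power :: "'v mps ^ 'n ^ 'n \<Rightarrow> 'v mps \<Rightarrow> 'v mps" where
  "det_id_minus_neg_power A \<beta> =
     mps_exp (\<beta> * suminf (\<lambda>t. const (1 / of_nat (Suc t)) * trace (mat_power A (Suc t))))"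

text \<open>The rows and columns of the block matrix: \<open>Inl i'\<close> for an index of \<open>B\<close>, and
  \<open>Inr (i, a)\<close> for the \<open>a\<close>-th copy of the index \<open>i\<close> of \<open>A\<close>. The entries do not depend on the
  copy labels; the multiplicities \<open>r\<close> enter through the index set alone.\<close>

definition block_index :: "('n \<Rightarrow> nat) \<Rightarrow> ('m + 'n \<times> nat) set" where
  "block_index r = UNIV <+> (SIGMA i:UNIV. {1..r i})"

fun block_entry :: "'a ^ 'm ^ 'm \<Rightarrow> 'a ^ 'n ^ 'm \<Rightarrow> 'a ^ 'm ^ 'n \<Rightarrow> 'a ^ 'n ^ 'n \<Rightarrow>
    'm + 'n \<times> nat \<Rightarrow> 'm + 'n \<times> nat \<Rightarrow> 'a" where
  "block_entry B U V A (Inl i') (Inl j') = B $ i' $ j'"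
| "block_entry B U V A (Inl i') (Inr (j, b)) = U $ i' $ j"
| "block_entry B U V A (Inr (i, a)) (Inl j') = V $ i $ j'"
| "block_entry B U V A (Inr (i, a)) (Inr (j, b)) = A $ i $ j"

datatype ('n, 'm) indet = Beta | Ent_A 'n 'n | Ent_B 'm 'm | Ent_U 'm 'n | Ent_V 'n 'm

end

theory Submission
  imports Defs
begin

text \<open>
  Fix an index \<open>i\<close> of \<open>A\<close>. The proof rests on the fact that adding one more copy of \<open>i\<close> to the block matrix
  acts on its extended permanent as a first-order differential operator. In a permutation, the new copy
  either is a fixed point, which gives a factor \<open>\<beta> A\<^sub>i\<^sub>i\<close>, or it sits on an arc from \<open>x\<close> to \<open>y\<close>, which
  replaces the entry \<open>M x y\<close> by \<open>M x i * M i y\<close> and leaves the number of cycles unchanged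
  (\<open>perm_insert\<close>). Summing over the arcs is applying a derivation, the insertion field of \<open>i\<close>.
  So, if \<open>P r\<close> is the permanent with multiplicities \<open>r\<close>, then \<open>P\<close> with one more copy of \<open>i\<close> is
  \<open>(\<beta> A\<^sub>i\<^sub>i + insertion) (P r)\<close> (\<open>block_perm_Suc\<close>).

  On the other hand every permutation uses each column of the block matrix exactly once, so \<open>P r\<close> is
  homogeneous of degree \<open>r i\<close> in the variables of column \<open>i\<close>. After division by the factorials of the
  multiplicities, the recursion says that the Euler field of column \<open>i\<close> acts on the sum of the series as
  \<open>\<beta> A\<^sub>i\<^sub>i + insertion\<close>. These equations, one for each \<open>i\<close>, and the part of degree zero in all
  columns determine a series (\<open>coeff_eq_weighted_perm\<close>).

  It remains to check the equations for the closed form. Let \<open>D\<close> be the Euler field of column \<open>i\<close> minus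
  the insertion field of \<open>i\<close>, let \<open>R\<close> be the Neumann inverse of \<open>A\<close> and \<open>E\<close> the matrix unit at \<open>(i, i)\<close>.
  Then \<open>D A = A E (I - A)\<close>, \<open>D U = U E (I - A)\<close>, \<open>D V = - A E V\<close> and \<open>D B = - U E V\<close>, whence
  \<open>D R = R A E\<close> and \<open>D (B + U R V) = 0\<close>. Moreover \<open>D\<close> maps \<open>- log det (I - A)\<close> to the trace of
  \<open>(D A) R = A E\<close>, which is \<open>A\<^sub>i\<^sub>i\<close>. So \<open>D\<close> multiplies the closed form by \<open>\<beta> A\<^sub>i\<^sub>i\<close>, as
  required (\<open>Euler_closed_form\<close>), and in column degree zero both sides are the extended permanent of \<open>B\<close>.
\<close>


section \<open>Coefficients and limits of formal power series\<close>

lemma coeff_0 [simp]: "coeff 0 m = 0"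
  and coeff_1: "coeff 1 m = (if m = 0 then 1 else 0)"
  and coeff_add [simp]: "coeff (f + g) m = coeff f m + coeff g m"
  and coeff_diff [simp]: "coeff (f - g) m = coeff f m - coeff g m"
  and coeff_mult: "coeff (f * g) m = (\<Sum>(a, b) | a + b = m. coeff f a * coeff g b)"
  and coeff_const: "coeff (const c) m = (if m = 0 then c else 0)"
  and coeff_Var: "coeff (Var v) m = (if m = Poly_Mapping.single v 1 then 1 else 0)"
  by (simp_all add: zero_mps.rep_eq one_mps.rep_eq plus_mps.rep_eq minus_mps.rep_eq
      times_mps.rep_eq const.rep_eq Var.rep_eq)

lemma coeff_sum [simp]: "coeff (sum f S) m = (\<Sum>x\<in>S. coeff (f x) m)"
  by (induction S rule: infinite_finite_induct) auto

lemma coeff_const_mult [simp]: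
  fixes f :: "'v mps"
  shows "coeff (const c * f) m = c * coeff f m"
proof -
  have "(\<Sum>(a, b) | a + b = m. coeff (const c) a * coeff f b) =
        (\<Sum>(a, b)\<in>{(0 :: 'v \<Rightarrow>\<^sub>0 nat, m)}. c * coeff f b)"
    by (rule sum.mono_neutral_cong_right) (auto simp: coeff_const split: if_splits)
  then show ?thesis
    by (simp add: coeff_mult)
qed

lemma const_1 [simp]: "const 1 = 1"
  by (rule mps_eqI) (simp add: coeff_const coeff_1)

lemma const_0 [simp]: "const 0 = 0"
  by (rule mps_eqI) (simp add: coeff_const)

lemma const_mult: "const c * const d = const (c * d)"
  by (rule mps_eqI) (simp, simp add: coeff_const)

lemma const_add: "const c + const d = const (c + d)"
  by (rule mps_eqI) (simp add: coeff_const)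

lemma of_nat_eq_const: "of_nat k = const (of_nat k)"
  by (induction k) (simp_all add: const_add [symmetric])

lemma eventually_coeff_nhds:
  fixes a :: "'v mps"
  shows "\<forall>\<^sub>F x in nhds a. coeff x m = coeff a m"
  using filterlim_ident [of "nhds a"] by (simp add: tendsto_mps_iff)

instance mps :: (type) topological_comm_monoid_add
proof
  fix a b :: "'a mps"
  have "\<forall>\<^sub>F x in nhds a \<times>\<^sub>F nhds b. coeff (fst x + snd x) m = coeff (a + b) m" for m
  proof -
    have "\<forall>\<^sub>F x in nhds a \<times>\<^sub>F nhds b. coeff (fst x) m = coeff a m \<and> coeff (snd x) m = coeff b m"
      by (intro eventually_prodI eventually_coeff_nhds)
    then show ?thesis by (rule eventually_mono) simp
  qed
  then show "LIM x nhds a \<times>\<^sub>F nhds b. fst x + snd x :> nhds (a + b)"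
    by (simp add: tendsto_mps_iff)
qed

instance mps :: (type) topological_semigroup_mult
proof
  fix f g :: "'a mps"
  have "\<forall>\<^sub>F x in nhds f \<times>\<^sub>F nhds g. coeff (fst x * snd x) m = coeff (f * g) m" for m
  proof -
    have "\<forall>\<^sub>F x in nhds f \<times>\<^sub>F nhds g.
        coeff (fst x) (fst p) = coeff f (fst p) \<and> coeff (snd x) (snd p) = coeff g (snd p)" for p
      by (intro eventually_prodI eventually_coeff_nhds)
    then have "\<forall>\<^sub>F x in nhds f \<times>\<^sub>F nhds g. \<forall>p\<in>{(a, b). a + b = m}.
        coeff (fst x) (fst p) = coeff f (fst p) \<and> coeff (snd x) (snd p) = coeff g (snd p)"
      by (intro eventually_ball_finite) auto
    then show ?thesis
      by (rule eventually_mono) (auto simp: coeff_mult intro!: sum.cong)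
  qed
  then show "LIM x nhds f \<times>\<^sub>F nhds g. fst x * snd x :> nhds (f * g)"
    by (simp add: tendsto_mps_iff)
qed

definition pdeg :: "('v::finite \<Rightarrow> bool) \<Rightarrow> ('v \<Rightarrow>\<^sub>0 nat) \<Rightarrow> nat" where
  "pdeg P m = (\<Sum>v | P v. Poly_Mapping.lookup m v)"

lemma pdeg_0 [simp]: "pdeg P 0 = 0"
  by (simp add: pdeg_def)

lemma pdeg_add [simp]: "pdeg P (a + b) = pdeg P a + pdeg P b"
  by (simp add: pdeg_def lookup_add sum.distrib)

lemma pdeg_single [simp]: "pdeg P (Poly_Mapping.single v k) = (if P v then k else 0)"
  by (auto simp: pdeg_def lookup_single when_def)

text \<open>A factor without constant term raises the order of a series. Hence only finitely many powers of
  such a series, or of a matrix of such series, contribute to a given coefficient.\<close>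

lemma coeff_mult_eq_0:
  fixes f g :: "'v::finite mps"
  assumes "coeff f 0 = 0"
    and "\<And>b. pdeg (\<lambda>_. True) b < pdeg (\<lambda>_. True) m \<Longrightarrow> coeff g b = 0"
  shows "coeff (f * g) m = 0"
proof -
  have "coeff f a * coeff g b = 0" if "a + b = m" for a b
  proof (cases "a = 0")
    case False
    then obtain v where "Poly_Mapping.lookup a v \<noteq> 0"
      by (auto simp: poly_mapping_eq_iff fun_eq_iff)
    then have "pdeg (\<lambda>_. True) a > 0"
      by (auto simp: pdeg_def sum_eq_0_iff intro: Nat.gr0I)
    with that have "coeff g b = 0"
      by (intro assms(2)) auto
    then show ?thesis by simp
  qed (simp add: assms(1))
  then have "(\<Sum>(a, b) | a + b = m. coeff f a * coeff g b) = 0"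
    by (intro sum.neutral) auto
  then show ?thesis
    by (simp add: coeff_mult)
qed

lemma coeff_power_eq_0:
  fixes f :: "'v::finite mps"
  assumes "coeff f 0 = 0" "pdeg (\<lambda>_. True) m < k"
  shows "coeff (f ^ k) m = 0"
  using assms(2)
proof (induction k arbitrary: m)
  case (Suc k)
  have "coeff (f * f ^ k) m = 0"
    by (rule coeff_mult_eq_0 [OF assms(1) Suc.IH]) (use Suc.prems in auto)
  then show ?case by simp
qed simp

lemma summable_mpsI:
  fixes f :: "nat \<Rightarrow> 'v mps"
  assumes "\<And>m k. N m < k \<Longrightarrow> coeff (f k) m = 0"
  shows "summable f"
proof -
  define s where "s = Abs_mps (\<lambda>m. \<Sum>k\<le>N m. coeff (f k) m)"
  have "(\<Sum>k<n. coeff (f k) m) = coeff s m" if "n > N m" for n m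
  proof -
    have "(\<Sum>k<n. coeff (f k) m) = (\<Sum>k\<le>N m. coeff (f k) m)"
      by (rule sum.mono_neutral_right) (use that assms in auto)
    then show ?thesis by (simp add: s_def Abs_mps_inverse)
  qed
  then have "f sums s"
    unfolding sums_def tendsto_mps_iff
    by (auto intro: eventually_mono [OF eventually_gt_at_top])
  then show ?thesis by (rule sums_summable)
qed

lemma summable_mps_exp:
  fixes f :: "'v::finite mps"
  assumes "coeff f 0 = 0"
  shows "summable (\<lambda>k. const (1 / fact k) * f ^ k)"
  by (rule summable_mpsI [where N = "pdeg (\<lambda>_. True)"]) (simp add: coeff_power_eq_0 assms)


section \<open>Vector fields acting on formal power series\<close>

lift_definition pdiff :: "'v \<Rightarrow> 'v mps \<Rightarrow> 'v mps" is
  "\<lambda>v f m. of_nat (Suc (Poly_Mapping.lookup m v)) * f (m + Poly_Mapping.single v 1)" .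

lemma coeff_pdiff: "coeff (pdiff v f) m =
    of_nat (Suc (Poly_Mapping.lookup m v)) * coeff f (m + Poly_Mapping.single v 1)"
  by (simp add: pdiff.rep_eq)

lemma pdiff_add: "pdiff v (f + g) = pdiff v f + pdiff v g"
  by (rule mps_eqI) (simp add: coeff_pdiff algebra_simps)

text \<open>The factor that \<^const>\<open>pdiff\<close> puts in front of a coefficient of the product is the exponent of
  \<open>v\<close>, which is the sum of the exponents of \<open>v\<close> in the two monomials multiplied. Splitting it
  accordingly, and cancelling one \<open>v\<close> from the monomial concerned, gives the two Leibniz terms.\<close>

lemma pdiff_mult: "pdiff v (f * g) = pdiff v f * g + f * pdiff v g"
proof (rule mps_eqI)
  fix m
  let ?e = "Poly_Mapping.single v (1::nat)"
  let ?l = "\<lambda>a. of_nat (Poly_Mapping.lookup a v) :: rat"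
  have shift: "\<exists>a'. a = a' + ?e" if "Poly_Mapping.lookup a v \<noteq> 0" for a :: "'a \<Rightarrow>\<^sub>0 nat"
    by (rule exI [of _ "a - ?e"], rule poly_mapping_eqI)
       (use that in \<open>auto simp: lookup_add lookup_minus lookup_single when_def\<close>)
  have half: "(\<Sum>(a, b) | a + b = m + ?e. ?l a * (coeff f a * coeff g b)) =
      coeff (pdiff v f * g) m" for f g
  proof -
    have "(\<Sum>(a, b) | a + b = m + ?e. ?l a * (coeff f a * coeff g b)) =
        (\<Sum>(a, b)\<in>(\<lambda>(a, b). (a + ?e, b)) ` {(a, b). a + b = m}. ?l a * (coeff f a * coeff g b))"
    proof (rule sum.mono_neutral_right)
      show "(\<lambda>(a, b). (a + ?e, b)) ` {(a, b). a + b = m} \<subseteq> {(a, b). a + b = m + ?e}"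
        by (auto simp: ac_simps)
      show "\<forall>p\<in>{(a, b). a + b = m + ?e} - (\<lambda>(a, b). (a + ?e, b)) ` {(a, b). a + b = m}.
          (case p of (a, b) \<Rightarrow> ?l a * (coeff f a * coeff g b)) = 0"
      proof (clarify)
        fix a b assume ab: "a + b = m + ?e"
          and notin: "(a, b) \<notin> (\<lambda>(a, b). (a + ?e, b)) ` {(a, b). a + b = m}"
        have "Poly_Mapping.lookup a v = 0"
        proof (rule ccontr)
          assume "Poly_Mapping.lookup a v \<noteq> 0"
          then obtain a' where a': "a = a' + ?e" using shift by blast
          then have "(a' + b) + ?e = m + ?e" using ab by (simp add: ac_simps)
          then have "a' + b = m" by simp
          with a' notin show False by force
        qed
        then show "?l a * (coeff f a * coeff g b) = 0" by simp
      qed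
    qed simp
    also have "\<dots> = (\<Sum>(a, b) | a + b = m. coeff (pdiff v f) a * coeff g b)"
      by (subst sum.reindex) (auto simp: inj_on_def coeff_pdiff lookup_add intro!: sum.cong)
    finally show ?thesis by (simp add: coeff_mult)
  qed
  have "coeff (pdiff v (f * g)) m =
      (\<Sum>(a, b) | a + b = m + ?e. (?l a + ?l b) * (coeff f a * coeff g b))"
    unfolding coeff_pdiff coeff_mult sum_distrib_left
  proof (rule sum.cong)
    fix p assume "p \<in> {(a, b). a + b = m + ?e}"
    then obtain a b where p: "p = (a, b)" and ab: "a + b = m + ?e" by blast
    have "Poly_Mapping.lookup (a + b) v = Suc (Poly_Mapping.lookup m v)"
      by (simp add: ab lookup_add)
    then have "of_nat (Suc (Poly_Mapping.lookup m v)) = ?l a + ?l b"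
      by (metis lookup_add of_nat_add)
    then show "of_nat (Suc (Poly_Mapping.lookup m v)) * (case p of (a, b) \<Rightarrow> coeff f a * coeff g b) =
        (case p of (a, b) \<Rightarrow> (?l a + ?l b) * (coeff f a * coeff g b))"
      by (simp add: p)
  qed simp
  also have "\<dots> = (\<Sum>(a, b) | a + b = m + ?e. ?l a * (coeff f a * coeff g b)) +
      (\<Sum>(a, b) | a + b = m + ?e. ?l b * (coeff f a * coeff g b))"
    by (simp add: case_prod_unfold ring_distribs sum.distrib)
  also have "(\<Sum>(a, b) | a + b = m + ?e. ?l b * (coeff f a * coeff g b)) =
      (\<Sum>(a, b) | a + b = m + ?e. ?l a * (coeff g a * coeff f b))"
    by (rule sum.reindex_bij_witness [where i = prod.swap and j = prod.swap]) (auto simp: ac_simps)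
  finally show "coeff (pdiff v (f * g)) m = coeff (pdiff v f * g + f * pdiff v g) m"
    by (simp only: half coeff_add mult.commute [of f])
qed

lemma pdiff_Var: "pdiff v (Var w) = (if v = w then 1 else 0)"
proof (rule mps_eqI)
  fix m :: "'a \<Rightarrow>\<^sub>0 nat"
  have "m + Poly_Mapping.single v 1 = Poly_Mapping.single w (1::nat) \<longleftrightarrow> v = w \<and> m = 0"
  proof
    assume *: "m + Poly_Mapping.single v 1 = Poly_Mapping.single w (1::nat)"
    then have "Poly_Mapping.lookup m v + 1 = (if w = v then 1 else 0)"
      by (metis lookup_add lookup_single_eq lookup_single_not_eq)
    then have "v = w" by (auto split: if_splits)
    with * show "v = w \<and> m = 0" by simp
  qed simp
  then show "coeff (pdiff v (Var w)) m = coeff (if v = w then 1 else 0) m"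
    by (auto simp: coeff_pdiff coeff_Var coeff_1)
qed

text \<open>Each coefficient of a derivative involves a single coefficient of the series; hence derivations
  are continuous and may be applied to convergent series term by term.\<close>

lemma tendsto_pdiff:
  assumes "(f \<longlongrightarrow> l) F"
  shows "((\<lambda>x. pdiff v (f x)) \<longlongrightarrow> pdiff v l) F"
  using assms unfolding tendsto_mps_iff coeff_pdiff by (auto elim: eventually_mono)

text \<open>This is the continuous derivation that maps each variable \<open>v\<close> to \<open>c v\<close>.\<close>

definition vfield :: "('v::finite \<Rightarrow> 'v mps) \<Rightarrow> 'v mps \<Rightarrow> 'v mps" where
  "vfield c f = (\<Sum>v\<in>UNIV. c v * pdiff v f)"

lemma vfield_Var [simp]: "vfield c (Var v) = c v"
  by (simp add: vfield_def pdiff_Var if_distrib [of "(*) _"] cong: if_cong)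

lemma vfield_add: "vfield c (f + g) = vfield c f + vfield c g"
  by (simp add: vfield_def pdiff_add algebra_simps sum.distrib)

lemma vfield_mult: "vfield c (f * g) = vfield c f * g + f * vfield c g"
  by (simp add: vfield_def pdiff_mult algebra_simps sum.distrib sum_distrib_left)

lemma vfield_0 [simp]: "vfield c 0 = 0"
  using vfield_add [of c 0 0] by simp

lemma vfield_1 [simp]: "vfield c 1 = 0"
  using vfield_mult [of c 1 1] by simp

lemma vfield_uminus: "vfield c (- f) = - vfield c f"
  using vfield_add [of c f "- f"] by (simp add: eq_neg_iff_add_eq_0 add.commute)

lemma vfield_diff: "vfield c (f - g) = vfield c f - vfield c g"
  using vfield_add [of c f "- g"] by (simp add: vfield_uminus)

lemma vfield_const [simp]:
  fixes c :: "'v::finite \<Rightarrow> 'v mps"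
  shows "vfield c (const d) = 0"
proof -
  have "pdiff v (const d) = 0" for v :: 'v
  proof (rule mps_eqI)
    fix m :: "'v \<Rightarrow>\<^sub>0 nat"
    have "Poly_Mapping.lookup (m + Poly_Mapping.single v 1) v \<noteq> 0"
      by (simp add: lookup_add)
    then have "m + Poly_Mapping.single v 1 \<noteq> 0"
      by (metis lookup_zero)
    then show "coeff (pdiff v (const d)) m = coeff 0 m"
      by (simp add: coeff_pdiff coeff_const)
  qed
  then show ?thesis by (simp add: vfield_def)
qed

lemma vfield_sum: "vfield c (sum f S) = (\<Sum>x\<in>S. vfield c (f x))"
  by (induction S rule: infinite_finite_induct) (simp_all add: vfield_add)

lemma vfield_power: "vfield c (f ^ Suc k) = of_nat (Suc k) * f ^ k * vfield c f"
  by (induction k) (simp_all add: vfield_mult algebra_simps)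

lemma vfield_prod:
  assumes "finite S"
  shows "vfield c (prod f S) = (\<Sum>x\<in>S. vfield c (f x) * prod f (S - {x}))"
  using assms
proof (induction S)
  case (insert y S)
  have "prod f (insert y S - {x}) = f y * prod f (S - {x})" if "x \<in> S" for x
  proof -
    have "insert y S - {x} = insert y (S - {x})" using insert.hyps that by auto
    then show ?thesis using insert.hyps by simp
  qed
  then have "(\<Sum>x\<in>S. vfield c (f x) * prod f (insert y S - {x})) =
      f y * (\<Sum>x\<in>S. vfield c (f x) * prod f (S - {x}))"
    by (simp add: sum_distrib_left ac_simps)
  then show ?case
    using insert.hyps by (simp add: vfield_mult insert.IH)
qed simp

lemma tendsto_vfield:
  "(f \<longlongrightarrow> l) F \<Longrightarrow> ((\<lambda>x. vfield c (f x)) \<longlongrightarrow> vfield c l) F"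
  unfolding vfield_def by (intro tendsto_sum tendsto_mult_left tendsto_pdiff)

lemma sums_vfield:
  assumes "f sums s"
  shows "(\<lambda>k. vfield c (f k)) sums vfield c s"
  using tendsto_vfield [OF assms [unfolded sums_def]] by (simp add: sums_def vfield_sum)

lemma sums_mps_mult_right:
  fixes f :: "nat \<Rightarrow> 'v mps"
  assumes "f sums s"
  shows "(\<lambda>k. f k * g) sums (s * g)"
  using tendsto_mult_right [OF assms [unfolded sums_def]] by (simp add: sums_def sum_distrib_right)

text \<open>The derivative of the term of index \<open>k + 1\<close> is the term of index \<open>k\<close> times the derivative of \<open>f\<close>.\<close>

lemma vfield_mps_exp:
  fixes f :: "'v::finite mps"
  assumes "coeff f 0 = 0"
  shows "vfield c (mps_exp f) = mps_exp f * vfield c f"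
proof -
  let ?t = "\<lambda>k. const (1 / fact k) * f ^ k"
  have sums: "?t sums mps_exp f"
    unfolding mps_exp_def by (rule summable_sums [OF summable_mps_exp [OF assms]])
  have "vfield c (?t (Suc k)) = ?t k * vfield c f" for k
  proof -
    have "const (1 / fact (Suc k)) * of_nat (Suc k) = (const (1 / fact k) :: 'v mps)"
      unfolding of_nat_eq_const const_mult by (simp add: field_simps del: of_nat_Suc)
    then show ?thesis
      by (simp only: vfield_mult vfield_const vfield_power mult_zero_left add_0 mult.assoc [symmetric])
  qed
  then have "(\<lambda>k. vfield c (?t (Suc k))) sums (mps_exp f * vfield c f)"
    using sums_mps_mult_right [OF sums, of "vfield c f"] by simp
  moreover have "(\<lambda>k. vfield c (?t k)) sums vfield c (mps_exp f)"
    by (rule sums_vfield [OF sums])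
  then have "(\<lambda>n. \<Sum>k<Suc n. vfield c (?t k)) \<longlonglongrightarrow> vfield c (mps_exp f)"
    unfolding sums_def by (rule LIMSEQ_Suc)
  then have "(\<lambda>k. vfield c (?t (Suc k))) sums vfield c (mps_exp f)"
    unfolding sums_def by (simp add: sum.lessThan_Suc_shift del: sum.lessThan_Suc power_Suc fact_Suc)
  ultimately show ?thesis
    using sums_unique2 by blast
qed


section \<open>Deleting an index from an extended permanent\<close>

lemma num_cycles_insert_fixed:
  assumes "finite X" "x \<notin> X" "p permutes X"
  shows "num_cycles (insert x X) p = Suc (num_cycles X p)"
proof -
  have "orbit p x = {x}"
    using assms by (simp add: orbit_eq_singleton_iff permutes_not_in)
  moreover have "{x} \<notin> orbit p ` X"
    using assms permutes_orbit_subset [OF assms(3)] by auto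
  ultimately show ?thesis
    using assms(1) by (simp add: num_cycles_def)
qed

text \<open>The permutation \<open>transpose x (p y) \<circ> p\<close> arises from \<open>p\<close> by inserting \<open>x\<close> between \<open>y\<close> and
  \<open>p y\<close>. Intersecting with \<open>X\<close> turns its cycles into those of \<open>p\<close>, and no two cycles become
  equal because each of them meets \<open>X\<close>.\<close>

lemma num_cycles_insert_after:
  assumes fin: "finite X" and x: "x \<notin> X" and p: "p permutes X" and y: "y \<in> X"
  shows "num_cycles (insert x X) (Transposition.transpose x (p y) \<circ> p) = num_cycles X p"
proof -
  define q where "q = Transposition.transpose x (p y) \<circ> p"
  have pX: "p u \<in> X" if "u \<in> X" for u
    using permutes_in_image [OF p] that by simp
  have q_x: "q x = p y"
    using x p by (simp add: q_def permutes_not_in)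
  have q_y: "q y = x"
    by (simp add: q_def)
  have q_other: "q u = p u" if "u \<in> X" "u \<noteq> y" for u
    using that x pX [OF that(1)] inj_eq [OF permutes_inj [OF p], of u y]
    by (auto simp: q_def Transposition.transpose_def)
  have q: "q permutes insert x X"
    unfolding q_def using y pX
    by (intro permutes_compose permutes_subset [OF p] permutes_swap_id) auto
  have self: "z \<in> orbit p z" for z
    using p fin by (intro permutation_self_in_orbit permutes_imp_permutation)
  have self_q: "z \<in> orbit q z" for z
    using q fin by (intro permutation_self_in_orbit permutes_imp_permutation) auto
  have eqI: "orbit q u = orbit q z" if "u \<in> orbit q z" for u z
    using that q fin by (intro orbit_cyclic_eq3 [OF cyclic_on_orbit [OF q]]) auto
  have trace: "orbit q z \<inter> X = orbit p z" if z: "z \<in> X" for z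
  proof
    have "(w \<in> X \<and> w \<in> orbit p z) \<or> (w = x \<and> y \<in> orbit p z)" if "w \<in> orbit q z" for w
      using that
    proof induction
      case base
      show ?case
      proof (cases "z = y")
        case False
        then have "q z = p z" using q_other z by blast
        then show ?thesis using pX [OF z] orbit.base [of p z] by simp
      qed (simp add: q_y self)
    next
      case (step w)
      then consider "w = x" "y \<in> orbit p z" | "w = y" "y \<in> orbit p z"
        | "w \<in> X" "w \<noteq> y" "w \<in> orbit p z" by blast
      then show ?case
      proof cases
        case 1
        then show ?thesis using q_x pX [OF y] orbit.step [of y p z] by simp
      next
        case 2
        then show ?thesis by (simp add: q_y)
      next
        case 3
        then show ?thesis using q_other [of w] pX [of w] orbit.step [of w p z] by simp
      qed
    qed
    then show "orbit q z \<inter> X \<subseteq> orbit p z" using x by blast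
  next
    have bypass: "p y = q (q y)"
      by (simp add: q_x q_y)
    have "w \<in> orbit q z" if "w \<in> orbit p z" for w
      using that
    proof induction
      case base
      show ?case
      proof (cases "z = y")
        case True
        then show ?thesis using bypass orbit.step [OF orbit.base [of q y]] by simp
      next
        case False
        then show ?thesis using q_other [OF z] orbit.base [of q z] by simp
      qed
    next
      case (step w)
      then have "w \<in> X" using permutes_orbit_subset [OF p z] by blast
      show ?case
      proof (cases "w = y")
        case True
        then show ?thesis using bypass orbit.step [OF orbit.step [OF step.IH]] by simp
      next
        case False
        then show ?thesis using q_other [OF \<open>w \<in> X\<close>] orbit.step [OF step.IH] by simp
      qed
    qed
    then show "orbit p z \<subseteq> orbit q z \<inter> X"
      using permutes_orbit_subset [OF p z] by blast
  qed
  have "x \<in> orbit q y"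
    using orbit.base [of q y] by (simp add: q_y)
  then have "orbit q x = orbit q y"
    by (rule eqI)
  then have "orbit q ` insert x X = orbit q ` X"
    using y by auto
  moreover have "inj_on (\<lambda>C. C \<inter> X) (orbit q ` X)"
  proof (rule inj_onI)
    fix O1 O2 assume "O1 \<in> orbit q ` X" "O2 \<in> orbit q ` X" and eq: "O1 \<inter> X = O2 \<inter> X"
    then obtain u v where u: "u \<in> X" "O1 = orbit q u" and v: "v \<in> X" "O2 = orbit q v" by blast
    then have "u \<in> orbit q v" using eq self_q [of u] by blast
    then show "O1 = O2" unfolding u v by (rule eqI)
  qed
  moreover have "orbit p ` X = (\<lambda>C. C \<inter> X) ` orbit q ` X"
    using trace by (auto simp: image_image)
  ultimately show ?thesis
    by (simp add: num_cycles_def q_def [symmetric] card_image)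
qed

text \<open>A permutation of \<open>insert x X\<close> either fixes \<open>x\<close> or has \<open>x\<close> inserted after some \<open>y \<in> X\<close>; the
  matrix entries used at \<open>y\<close> and \<open>x\<close> are then collected into the row of \<open>y\<close>.\<close>

lemma perm_insert:
  fixes \<beta> :: "'a::comm_semiring_1"
  assumes fin: "finite X" and x: "x \<notin> X"
  shows "perm \<beta> (insert x X) M =
    \<beta> * M x x * perm \<beta> X M + (\<Sum>y\<in>X. perm \<beta> X (M(y := \<lambda>z. M y x * M x z)))"
proof -
  define w where "w q = \<beta> ^ num_cycles (insert x X) q * (\<Prod>u\<in>insert x X. M u (q u))" for q
  have fixed: "w p = \<beta> * M x x * (\<beta> ^ num_cycles X p * (\<Prod>u\<in>X. M u (p u)))"
    if p: "p permutes X" for p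
    using fin x p by (simp add: w_def num_cycles_insert_fixed permutes_not_in ac_simps)
  have moved: "w (Transposition.transpose x (p y) \<circ> p) =
      \<beta> ^ num_cycles X p * (\<Prod>u\<in>X. (M(y := \<lambda>z. M y x * M x z)) u (p u))"
    if p: "p permutes X" and y: "y \<in> X" for p y
  proof -
    let ?q = "Transposition.transpose x (p y) \<circ> p"
    have pX: "p u \<in> X" if "u \<in> X" for u
      using permutes_in_image [OF p] that by simp
    have other: "?q u = p u" if "u \<in> X - {y}" for u
      using that x pX [of u] inj_eq [OF permutes_inj [OF p], of u y]
      by (auto simp: Transposition.transpose_def)
    have "(\<Prod>u\<in>insert x X. M u (?q u)) = M x (p y) * (\<Prod>u\<in>X. M u (?q u))"
      using fin x p by (simp add: permutes_not_in)
    also have "(\<Prod>u\<in>X. M u (?q u)) = M y x * (\<Prod>u\<in>X - {y}. M u (?q u))"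
      using fin y by (subst prod.remove [of _ y]) auto
    also have "(\<Prod>u\<in>X - {y}. M u (?q u)) = (\<Prod>u\<in>X - {y}. M u (p u))"
      using other by (intro prod.cong) auto
    also have "M x (p y) * (M y x * (\<Prod>u\<in>X - {y}. M u (p u))) =
        (\<Prod>u\<in>X. (M(y := \<lambda>z. M y x * M x z)) u (p u))"
      using fin y by (subst (2) prod.remove [of _ y]) (auto simp: ac_simps intro!: prod.cong)
    finally show ?thesis
      by (simp add: w_def num_cycles_insert_after [OF fin x p y] del: o_apply)
  qed
  have "perm \<beta> (insert x X) M =
      (\<Sum>b\<in>insert x X. \<Sum>p | p permutes X. w (Transposition.transpose x b \<circ> p))"
    unfolding perm_def w_def [symmetric] by (rule sum_over_permutations_insert [OF fin x])
  also have "\<dots> = (\<Sum>p | p permutes X. w p) +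
      (\<Sum>p | p permutes X. \<Sum>b\<in>X. w (Transposition.transpose x b \<circ> p))"
    using fin x by (simp add: sum.swap [of _ X])
  also have "(\<Sum>p | p permutes X. \<Sum>b\<in>X. w (Transposition.transpose x b \<circ> p)) =
      (\<Sum>p | p permutes X. \<Sum>y\<in>X. w (Transposition.transpose x (p y) \<circ> p))"
  proof (rule sum.cong)
    fix p assume "p \<in> {p. p permutes X}"
    then show "(\<Sum>b\<in>X. w (Transposition.transpose x b \<circ> p)) =
        (\<Sum>y\<in>X. w (Transposition.transpose x (p y) \<circ> p))"
      using sum.permute [of p X "\<lambda>b. w (Transposition.transpose x b \<circ> p)"] by (simp add: o_def)
  qed simp
  also have "(\<Sum>p | p permutes X. w p) = \<beta> * M x x * perm \<beta> X M"
    unfolding perm_def sum_distrib_left by (rule sum.cong) (use fixed in auto)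
  also have "(\<Sum>p | p permutes X. \<Sum>y\<in>X. w (Transposition.transpose x (p y) \<circ> p)) =
      (\<Sum>y\<in>X. perm \<beta> X (M(y := \<lambda>z. M y x * M x z)))"
    unfolding perm_def by (subst sum.swap, intro sum.cong refl) (use moved in auto)
  finally show ?thesis .
qed

lemma perm_empty [simp]: "perm \<beta> {} M = 1"
  by (simp add: perm_def num_cycles_def)

text \<open>By induction on \<open>X\<close>, since both sides satisfy the recursion of \<open>perm_insert\<close>.\<close>

lemma perm_image:
  assumes "finite X" "inj_on f X"
  shows "perm \<beta> (f ` X) M = perm \<beta> X (\<lambda>x y. M (f x) (f y))"
  using assms
proof (induction X arbitrary: M)
  case (insert x X)
  have "perm \<beta> (f ` X) (M(f y := \<lambda>z. M (f y) (f x) * M (f x) z)) =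
      perm \<beta> X ((\<lambda>u z. M (f u) (f z))(y := \<lambda>z. M (f y) (f x) * M (f x) (f z)))" if y: "y \<in> X" for y
  proof -
    have "perm \<beta> (f ` X) (M(f y := \<lambda>z. M (f y) (f x) * M (f x) z)) =
        perm \<beta> X (\<lambda>u z. (M(f y := \<lambda>z. M (f y) (f x) * M (f x) z)) (f u) (f z))"
      using insert by (intro insert.IH) auto
    also have "\<dots> = perm \<beta> X ((\<lambda>u z. M (f u) (f z))(y := \<lambda>z. M (f y) (f x) * M (f x) (f z)))"
      unfolding perm_def
      by (intro sum.cong refl arg_cong2 [where f = "(*)"] prod.cong)
         (use insert.prems y in \<open>auto simp: inj_on_def\<close>)
    finally show ?thesis .
  qed
  then show ?case
    using insert by (auto simp: perm_insert sum.reindex)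
qed simp

text \<open>By multilinearity in the rows, a derivation acts on an extended permanent by acting on one row
  at a time.\<close>

lemma vfield_perm:
  assumes fin: "finite X" and \<beta>: "vfield c \<beta> = 0"
  shows "vfield c (perm \<beta> X M) = (\<Sum>y\<in>X. perm \<beta> X (M(y := \<lambda>z. vfield c (M y z))))"
proof -
  have pow: "vfield c (\<beta> ^ k) = 0" for k
    by (cases k) (simp_all add: vfield_power \<beta> del: power_Suc)
  have by_rows: "vfield c (\<beta> ^ k * (\<Prod>x\<in>X. M x (p x))) =
      (\<Sum>y\<in>X. \<beta> ^ k * (\<Prod>x\<in>X. (M(y := \<lambda>z. vfield c (M y z))) x (p x)))" for k p
  proof -
    have "vfield c (M y (p y)) * (\<Prod>x\<in>X - {y}. M x (p x)) =
        (\<Prod>x\<in>X. (M(y := \<lambda>z. vfield c (M y z))) x (p x))" if "y \<in> X" for y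
    proof -
      have "(\<Prod>x\<in>X - {y}. M x (p x)) =
          (\<Prod>x\<in>X - {y}. (M(y := \<lambda>z. vfield c (M y z))) x (p x))"
        by (rule prod.cong) auto
      then show ?thesis
        using fin that by (simp add: prod.remove [of X y])
    qed
    then show ?thesis
      by (simp add: vfield_mult pow vfield_prod [OF fin] sum_distrib_left)
  qed
  show ?thesis
    unfolding perm_def vfield_sum by_rows by (rule sum.swap)
qed


section \<open>Matrices of formal power series\<close>

abbreviation matrix_vfield ::
    "('v::finite \<Rightarrow> 'v mps) \<Rightarrow> 'v mps ^ 'n ^ 'm \<Rightarrow> 'v mps ^ 'n ^ 'm" where
  "matrix_vfield c \<equiv> map_matrix (vfield c)"

lemma matrix_vfield_mult:
  "matrix_vfield c (X ** Y) = matrix_vfield c X ** Y + X ** matrix_vfield c Y"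
  by (simp add: vec_eq_iff matrix_matrix_mult_def vfield_sum vfield_mult sum.distrib)

lemma matrix_vfield_add: "matrix_vfield c (X + Y) = matrix_vfield c X + matrix_vfield c Y"
  and matrix_vfield_diff: "matrix_vfield c (X - Y) = matrix_vfield c X - matrix_vfield c Y"
  by (simp_all add: vec_eq_iff vfield_add vfield_diff)

lemma matrix_vfield_mat_1 [simp]: "matrix_vfield c (mat 1) = 0"
  by (simp add: vec_eq_iff mat_def)

lemma vfield_trace: "vfield c (trace X) = trace (matrix_vfield c X)"
  by (simp add: trace_def vfield_sum)

lemma matrix_diff_ldistrib:
  fixes X :: "'a::comm_ring_1 ^ 'n ^ 'm"
  shows "X ** (Y - Z) = X ** Y - X ** Z"
  by (simp add: vec_eq_iff matrix_matrix_mult_def sum_subtractf algebra_simps)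

lemma matrix_diff_rdistrib:
  fixes X :: "'a::comm_ring_1 ^ 'n ^ 'm"
  shows "(X - Y) ** Z = X ** Z - Y ** Z"
  by (simp add: vec_eq_iff matrix_matrix_mult_def sum_subtractf algebra_simps)

lemma matrix_uminus_right:
  fixes X :: "'a::comm_ring_1 ^ 'n ^ 'm"
  shows "X ** (- Y) = - (X ** Y)"
  by (simp add: vec_eq_iff matrix_matrix_mult_def sum_negf)

lemma matrix_add_rdistrib:
  fixes X :: "'a::comm_ring_1 ^ 'n ^ 'm"
  shows "(X + Y) ** Z = X ** Z + Y ** Z"
  by (simp add: vec_eq_iff matrix_matrix_mult_def sum.distrib algebra_simps)

lemma tendsto_matrix_mult:
  fixes x :: "'v mps ^ 'n ^ 'm" and y :: "'v mps ^ 'k ^ 'n"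
  assumes "(X \<longlongrightarrow> x) F" "(Y \<longlongrightarrow> y) F"
  shows "((\<lambda>a. X a ** Y a) \<longlongrightarrow> x ** y) F"
  unfolding matrix_matrix_mult_def
  by (intro tendsto_vec_lambda tendsto_sum tendsto_mult tendsto_vec_nth assms)

lemma tendsto_trace:
  fixes x :: "'v mps ^ 'n ^ 'n"
  assumes "(X \<longlongrightarrow> x) F"
  shows "((\<lambda>a. trace (X a)) \<longlongrightarrow> trace x) F"
  unfolding trace_def by (intro tendsto_sum tendsto_vec_nth assms)

lemma matrix_tendsto_unique:
  fixes x y :: "'v mps ^ 'n ^ 'm"
  assumes "X \<longlonglongrightarrow> x" "X \<longlonglongrightarrow> y"
  shows "x = y"
proof -
  have "x $ i $ j = y $ i $ j" for i j
    using assms by (intro LIMSEQ_unique [of "\<lambda>k. X k $ i $ j"] tendsto_vec_nth)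
  then show ?thesis by (simp add: vec_eq_iff)
qed

lemma mat_power_commute: "mat_power A k ** A = A ** mat_power A k"
  by (induction k) (simp_all add: matrix_mul_assoc [symmetric])

lemma coeff_mat_power_eq_0:
  fixes A :: "'v::finite mps ^ 'n ^ 'n"
  assumes A: "\<And>i j. coeff (A $ i $ j) 0 = 0" and "pdeg (\<lambda>_. True) m < k"
  shows "coeff (mat_power A k $ i $ j) m = 0"
  using assms(2)
proof (induction k arbitrary: m i)
  case (Suc k)
  have "coeff (A $ i $ l * mat_power A k $ l $ j) m = 0" for l
    by (rule coeff_mult_eq_0 [OF A Suc.IH]) (use Suc.prems in auto)
  then show ?case
    by (simp add: matrix_matrix_mult_def)
qed simp

text \<open>As a formal series this is the negative logarithm of \<open>det (I - A)\<close>.\<close>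

definition log_det_series :: "'v mps ^ 'n ^ 'n \<Rightarrow> 'v mps" where
  "log_det_series A = suminf (\<lambda>t. const (1 / of_nat (Suc t)) * trace (mat_power A (Suc t)))"

context
  fixes A :: "'v::finite mps ^ 'n ^ 'n"
  assumes no_const: "\<And>i j. coeff (A $ i $ j) 0 = 0"
begin

lemma sums_neumann_inverse: "mat_power A sums neumann_inverse A"
proof -
  define R where "R = (\<chi> i j. suminf (\<lambda>k. mat_power A k $ i $ j))"
  have "(\<lambda>k. mat_power A k $ i $ j) sums R $ i $ j" for i j
    unfolding R_def
    by (simp, rule summable_sums, rule summable_mpsI [where N = "pdeg (\<lambda>_. True)"])
       (simp add: coeff_mat_power_eq_0 no_const)
  then have "mat_power A sums R"
    unfolding sums_def by (intro vec_tendstoI) (simp add: sum_component)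
  moreover from this have "neumann_inverse A = R"
    unfolding neumann_inverse_def suminf_def
    by (intro the_equality) (auto simp: sums_def intro: matrix_tendsto_unique)
  ultimately show ?thesis by simp
qed

lemma neumann_inverse_right: "(mat 1 - A) ** neumann_inverse A = mat 1"
proof -
  let ?S = "\<lambda>n. \<Sum>k<n. mat_power A k"
  have S: "?S \<longlonglongrightarrow> neumann_inverse A"
    using sums_neumann_inverse by (simp add: sums_def)
  have "(\<Sum>k<n. A ** mat_power A k) = A ** ?S n" for n
    by (induction n) (simp_all add: matrix_add_ldistrib)
  then have "?S (Suc n) = mat 1 + A ** ?S n" for n
    by (simp add: sum.lessThan_Suc_shift del: sum.lessThan_Suc)
  moreover have "(\<lambda>n. mat 1 + A ** ?S n) \<longlonglongrightarrow> mat 1 + A ** neumann_inverse A"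
  proof (intro vec_tendstoI)
    fix i j
    have "(\<lambda>n. A ** ?S n) \<longlonglongrightarrow> A ** neumann_inverse A"
      by (intro tendsto_matrix_mult tendsto_const S)
    then have "(\<lambda>n. mat 1 $ i $ j + (A ** ?S n) $ i $ j) \<longlonglongrightarrow> mat 1 $ i $ j + (A ** neumann_inverse A) $ i $ j"
      by (intro tendsto_add tendsto_const tendsto_vec_nth)
    then show "(\<lambda>n. (mat 1 + A ** ?S n) $ i $ j) \<longlonglongrightarrow> (mat 1 + A ** neumann_inverse A) $ i $ j"
      by simp
  qed
  ultimately have "neumann_inverse A = mat 1 + A ** neumann_inverse A"
    using LIMSEQ_Suc [OF S] by (auto intro: matrix_tendsto_unique)
  then show ?thesis
    by (simp add: matrix_diff_rdistrib algebra_simps)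
qed

lemma neumann_inverse_commute: "neumann_inverse A ** A = A ** neumann_inverse A"
proof (rule matrix_tendsto_unique)
  let ?S = "\<lambda>n. \<Sum>k<n. mat_power A k"
  have S: "?S \<longlonglongrightarrow> neumann_inverse A"
    using sums_neumann_inverse by (simp add: sums_def)
  have "?S n ** A = A ** ?S n" for n
    by (induction n) (simp_all add: matrix_add_ldistrib matrix_add_rdistrib mat_power_commute)
  moreover show "(\<lambda>n. A ** ?S n) \<longlonglongrightarrow> A ** neumann_inverse A"
    by (intro tendsto_matrix_mult tendsto_const S)
  ultimately show "(\<lambda>n. A ** ?S n) \<longlonglongrightarrow> neumann_inverse A ** A"
    using tendsto_matrix_mult [OF S tendsto_const [of A]] by simp
qed

lemma neumann_inverse_left: "neumann_inverse A ** (mat 1 - A) = mat 1"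
  using neumann_inverse_right
  by (simp add: matrix_diff_ldistrib matrix_diff_rdistrib neumann_inverse_commute)

text \<open>Write \<open>R\<close> for the Neumann inverse. Differentiating \<open>(I - A) R = I\<close> gives \<open>(I - A) R' = A' R\<close>, and
  multiplication by \<open>R\<close> on the left solves this for \<open>R'\<close>.\<close>

lemma matrix_vfield_neumann_inverse:
  "matrix_vfield c (neumann_inverse A) =
    neumann_inverse A ** matrix_vfield c A ** neumann_inverse A"
proof -
  let ?R = "neumann_inverse A" and ?D = "matrix_vfield c"
  have "?D ((mat 1 - A) ** ?R) = 0"
    by (simp add: neumann_inverse_right)
  then have "(mat 1 - A) ** ?D ?R = ?D A ** ?R"
    by (simp add: matrix_vfield_mult matrix_vfield_diff matrix_diff_rdistrib algebra_simps)
  then have "?R ** (mat 1 - A) ** ?D ?R = ?R ** ?D A ** ?R"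
    by (simp add: matrix_mul_assoc [symmetric])
  then show ?thesis
    by (simp add: neumann_inverse_left)
qed

lemma sums_log_det_series:
  "(\<lambda>t. const (1 / of_nat (Suc t)) * trace (mat_power A (Suc t))) sums log_det_series A"
  unfolding log_det_series_def
  by (rule summable_sums, rule summable_mpsI [where N = "pdeg (\<lambda>_. True)"])
     (simp add: trace_def coeff_mat_power_eq_0 no_const del: mat_power.simps of_nat_Suc)

text \<open>A derivation turns a power of \<open>A\<close> into a sum of words with one letter replaced by the derivative
  of \<open>A\<close>. Under the trace all these words are cyclic rotations of each other.\<close>

lemma vfield_trace_mat_power:
  "vfield c (trace (mat_power A (Suc k))) =
    of_nat (Suc k) * trace (matrix_vfield c A ** mat_power A k)"
proof -
  \<comment> \<open>The extra factor absorbs the letters that a rotation moves to the end. For \<open>k = 0\<close> both sides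
    vanish, so the truncated subtraction is harmless.\<close>
  have "trace (matrix_vfield c (mat_power A k) ** mat_power A j) =
      of_nat k * trace (matrix_vfield c A ** mat_power A (k + j - 1))" for k j
  proof (induction k arbitrary: j)
    case (Suc k)
    let ?D = "matrix_vfield c"
    have add: "mat_power A k ** mat_power A j = mat_power A (k + j)" for j
      by (induction k) (simp_all add: matrix_mul_assoc [symmetric])
    have "trace (?D (mat_power A (Suc k)) ** mat_power A j) =
        trace (?D A ** mat_power A (k + j)) + trace (A ** (?D (mat_power A k) ** mat_power A j))"
      by (simp add: matrix_vfield_mult matrix_add_rdistrib trace_add matrix_mul_assoc [symmetric] add)
    also have "trace (A ** (?D (mat_power A k) ** mat_power A j)) =
        trace (?D (mat_power A k) ** mat_power A (Suc j))"
      by (subst trace_mul_sym) (simp add: matrix_mul_assoc [symmetric] mat_power_commute)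
    also have "\<dots> = of_nat k * trace (?D A ** mat_power A (k + j))"
      using Suc.IH [of "Suc j"] by (simp del: mat_power.simps)
    finally show ?case
      by (simp add: algebra_simps del: mat_power.simps)
  qed (simp add: trace_def)
  from this [of "Suc k" 0] show ?thesis
    by (simp add: vfield_trace del: mat_power.simps(2) of_nat_Suc)
qed

text \<open>The factor \<open>t\<close> produced by the derivative of the trace of the \<open>t\<close>-th power cancels the
  denominator, and the remaining powers of \<open>A\<close> add up to the Neumann inverse: this is Jacobi's formula for
  the derivative of \<open>- log det (I - A)\<close>.\<close>

lemma vfield_log_det_series:
  "vfield c (log_det_series A) = trace (matrix_vfield c A ** neumann_inverse A)"
proof -
  let ?D = "matrix_vfield c A"
  have "vfield c (const (1 / of_nat (Suc t)) * trace (mat_power A (Suc t))) =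
      trace (?D ** mat_power A t)" for t
  proof -
    have "vfield c (const (1 / of_nat (Suc t)) * trace (mat_power A (Suc t))) =
        const (1 / of_nat (Suc t)) * const (of_nat (Suc t)) * trace (?D ** mat_power A t)"
      by (simp only: vfield_mult vfield_const vfield_trace_mat_power of_nat_eq_const
          mult_zero_left add_0 mult.assoc)
    also have "const (1 / of_nat (Suc t)) * const (of_nat (Suc t)) = (1 :: 'v mps)"
      by (simp add: const_mult del: of_nat_Suc)
    finally show ?thesis by simp
  qed
  then have "(\<lambda>t. trace (?D ** mat_power A t)) sums vfield c (log_det_series A)"
    using sums_vfield [OF sums_log_det_series, of c] by simp
  then have "(\<lambda>n. \<Sum>t<n. trace (?D ** mat_power A t)) \<longlonglongrightarrow> vfield c (log_det_series A)"
    by (simp add: sums_def)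
  moreover have "(\<Sum>t<n. trace (?D ** mat_power A t)) = trace (?D ** (\<Sum>t<n. mat_power A t))" for n
    by (induction n) (simp_all add: matrix_add_ldistrib trace_add, simp add: trace_def)
  moreover have "(\<lambda>n. trace (?D ** (\<Sum>t<n. mat_power A t))) \<longlonglongrightarrow> trace (?D ** neumann_inverse A)"
    using sums_neumann_inverse
    by (intro tendsto_trace tendsto_matrix_mult tendsto_const) (simp add: sums_def)
  ultimately show ?thesis
    using LIMSEQ_unique by fastforce
qed

end


section \<open>Gradings and truncation\<close>

lemma coeff_mult_nonzeroE:
  assumes "coeff (f * g) m \<noteq> 0"
  obtains a b where "a + b = m" "coeff f a \<noteq> 0" "coeff g b \<noteq> 0"
proof -
  have "(\<Sum>(a, b) | a + b = m. coeff f a * coeff g b) \<noteq> 0"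
    using assms by (simp add: coeff_mult)
  then obtain p where "p \<in> {(a, b). a + b = m}" "(case p of (a, b) \<Rightarrow> coeff f a * coeff g b) \<noteq> 0"
    by (rule sum.not_neutral_contains_not_neutral)
  then show ?thesis
    using that by auto
qed

definition homog :: "('v::finite \<Rightarrow> bool) \<Rightarrow> nat \<Rightarrow> 'v mps \<Rightarrow> bool" where
  "homog P d f \<longleftrightarrow> (\<forall>m. coeff f m \<noteq> 0 \<longrightarrow> pdeg P m = d)"

lemma homogD: "homog P d f \<Longrightarrow> coeff f m \<noteq> 0 \<Longrightarrow> pdeg P m = d"
  by (simp add: homog_def)

lemma homog_0 [simp]: "homog P d 0"
  by (simp add: homog_def)

lemma homog_1: "homog P 0 1"
  by (simp add: homog_def coeff_1)

lemma homog_Var: "homog P (if P v then 1 else 0) (Var v)"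
  by (simp add: homog_def coeff_Var)

lemma homog_mult: "homog P d f \<Longrightarrow> homog P e g \<Longrightarrow> homog P (d + e) (f * g)"
  unfolding homog_def by (metis coeff_mult_nonzeroE pdeg_add)

lemma homog_const_mult: "homog P d f \<Longrightarrow> homog P d (const c * f)"
  by (simp add: homog_def)

lemma homog_power: "homog P 0 f \<Longrightarrow> homog P 0 (f ^ k)"
  by (induction k) (use homog_1 homog_mult [of P 0 f 0] in auto)

lemma homog_sum:
  assumes "\<And>x. x \<in> S \<Longrightarrow> homog P d (f x)"
  shows "homog P d (sum f S)"
  unfolding homog_def
proof (intro allI impI)
  fix m assume "coeff (sum f S) m \<noteq> 0"
  then obtain x where "x \<in> S" "coeff (f x) m \<noteq> 0"
    by (auto elim: sum.not_neutral_contains_not_neutral)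
  with assms show "pdeg P m = d"
    by (auto dest: homogD)
qed

lemma homog_prod:
  assumes "\<And>x. x \<in> S \<Longrightarrow> homog P (d x) (f x)"
  shows "homog P (sum d S) (prod f S)"
  using assms by (induction S rule: infinite_finite_induct) (simp_all add: homog_1 homog_mult)

text \<open>A permutation meets every column exactly once, so an extended permanent is homogeneous
  whenever the degree of an entry depends on its column only.\<close>

lemma homog_perm:
  assumes "homog P 0 \<beta>" "\<And>x y. x \<in> X \<Longrightarrow> y \<in> X \<Longrightarrow> homog P (d y) (M x y)"
  shows "homog P (sum d X) (perm \<beta> X M)"
  unfolding perm_def
proof (rule homog_sum)
  fix p assume "p \<in> {p. p permutes X}"
  then have p: "p permutes X" by simp
  have "homog P (\<Sum>x\<in>X. d (p x)) (\<Prod>x\<in>X. M x (p x))"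
    using permutes_in_image [OF p] by (intro homog_prod assms) auto
  moreover have "(\<Sum>x\<in>X. d (p x)) = sum d X"
    using sum.permute [OF p, of d] by (simp add: o_def)
  ultimately show "homog P (sum d X) (\<beta> ^ num_cycles X p * (\<Prod>x\<in>X. M x (p x)))"
    using homog_mult [OF homog_power [OF assms(1)]] by fastforce
qed

text \<open>This vector field is the Euler field of the variables selected by \<open>P\<close>: its summand for \<open>v\<close>
  multiplies a monomial by its exponent of \<open>v\<close>.\<close>

lemma coeff_vfield_Euler:
  "coeff (vfield (\<lambda>v. if P v then Var v else 0) f) m = of_nat (pdeg P m) * coeff f m"
proof -
  have "coeff (Var v * pdiff v f) m = of_nat (Poly_Mapping.lookup m v) * coeff f m" for v
  proof (cases "Poly_Mapping.lookup m v = 0")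
    case True
    have "coeff (Var v * pdiff v f) m = 0"
    proof (rule ccontr)
      assume "coeff (Var v * pdiff v f) m \<noteq> 0"
      then obtain a b where "a + b = m" "coeff (Var v) a \<noteq> 0"
        by (rule coeff_mult_nonzeroE)
      then have "m = Poly_Mapping.single v 1 + b"
        by (auto simp: coeff_Var split: if_splits)
      with True show False by (simp add: lookup_add)
    qed
    with True show ?thesis by simp
  next
    case False
    define b where "b = m - Poly_Mapping.single v 1"
    have m: "m = Poly_Mapping.single v 1 + b"
      by (rule poly_mapping_eqI)
         (use False in \<open>auto simp: b_def lookup_add lookup_minus lookup_single when_def\<close>)
    have "coeff (Var v * pdiff v f) m =
        (\<Sum>(a, b)\<in>{(Poly_Mapping.single v (1 :: nat), b)}. coeff (pdiff v f) b)"
      unfolding coeff_mult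
      by (rule sum.mono_neutral_cong_right) (auto simp: m coeff_Var split: if_splits)
    then show ?thesis
      by (simp add: coeff_pdiff m lookup_add add.commute)
  qed
  moreover have "vfield (\<lambda>v. if P v then Var v else 0) f = (\<Sum>v | P v. Var v * pdiff v f)"
    unfolding vfield_def by (rule sum.mono_neutral_cong_right) auto
  ultimately show ?thesis
    by (simp add: pdeg_def sum_distrib_right)
qed

text \<open>Equality after the variables selected by \<open>P\<close> have been set to zero.\<close>

definition eq_at_0 :: "('v::finite \<Rightarrow> bool) \<Rightarrow> 'v mps \<Rightarrow> 'v mps \<Rightarrow> bool" where
  "eq_at_0 P f g \<longleftrightarrow> (\<forall>m. pdeg P m = 0 \<longrightarrow> coeff f m = coeff g m)"

lemma eq_at_0_refl [simp]: "eq_at_0 P f f"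
  by (simp add: eq_at_0_def)

lemma eq_at_0_Var: "P v \<Longrightarrow> eq_at_0 P (Var v) 0"
  using homog_Var [of P v] by (auto simp: eq_at_0_def homog_def)

lemma eq_at_0_add: "eq_at_0 P f f' \<Longrightarrow> eq_at_0 P g g' \<Longrightarrow> eq_at_0 P (f + g) (f' + g')"
  by (simp add: eq_at_0_def)

lemma eq_at_0_mult:
  assumes "eq_at_0 P f f'" "eq_at_0 P g g'"
  shows "eq_at_0 P (f * g) (f' * g')"
  unfolding eq_at_0_def coeff_mult
  by (intro allI impI sum.cong) (use assms in \<open>auto simp: eq_at_0_def\<close>)

lemma eq_at_0_mult_zero:
  "eq_at_0 P f 0 \<Longrightarrow> eq_at_0 P (f * g) 0" "eq_at_0 P g 0 \<Longrightarrow> eq_at_0 P (f * g) 0"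
  using eq_at_0_mult [of P f 0 g g] eq_at_0_mult [of P f f g 0] by simp_all

lemma eq_at_0_sum:
  "(\<And>x. x \<in> S \<Longrightarrow> eq_at_0 P (f x) (g x)) \<Longrightarrow> eq_at_0 P (sum f S) (sum g S)"
  by (induction S rule: infinite_finite_induct) (auto intro: eq_at_0_add)

lemma eq_at_0_sum_zero: "(\<And>x. x \<in> S \<Longrightarrow> eq_at_0 P (f x) 0) \<Longrightarrow> eq_at_0 P (sum f S) 0"
  using eq_at_0_sum [of S P f "\<lambda>_. 0"] by simp

lemma eq_at_0_prod:
  "(\<And>x. x \<in> S \<Longrightarrow> eq_at_0 P (f x) (g x)) \<Longrightarrow> eq_at_0 P (prod f S) (prod g S)"
  by (induction S rule: infinite_finite_induct) (auto intro: eq_at_0_mult)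

lemma eq_at_0_perm:
  "(\<And>x y. eq_at_0 P (M x y) (M' x y)) \<Longrightarrow> eq_at_0 P (perm \<beta> X M) (perm \<beta> X M')"
  unfolding perm_def by (intro eq_at_0_sum eq_at_0_mult eq_at_0_prod) auto

lemma eq_at_0_limit:
  assumes "f \<longlonglongrightarrow> l" "\<And>n. eq_at_0 P (f n) g"
  shows "eq_at_0 P l g"
  unfolding eq_at_0_def
proof (intro allI impI)
  fix m assume "pdeg P m = 0"
  then have "coeff (f n) m = coeff g m" for n
    using assms(2) by (simp add: eq_at_0_def)
  moreover have "\<forall>\<^sub>F n in sequentially. coeff (f n) m = coeff l m"
    using assms(1) by (simp add: tendsto_mps_iff)
  ultimately show "coeff l m = coeff g m"
    using eventually_happens' [OF sequentially_bot] by fastforce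
qed

lemma eq_at_0_log_det_series:
  assumes "\<And>i j. coeff (A $ i $ j) 0 = 0" "\<And>i j. eq_at_0 P (A $ i $ j) 0"
  shows "eq_at_0 P (log_det_series A) 0"
proof (rule eq_at_0_limit)
  show "(\<lambda>n. \<Sum>t<n. const (1 / of_nat (Suc t)) * trace (mat_power A (Suc t))) \<longlonglongrightarrow> log_det_series A"
    using sums_log_det_series [OF assms(1)] by (simp add: sums_def)
  show "eq_at_0 P (\<Sum>t<n. const (1 / of_nat (Suc t)) * trace (mat_power A (Suc t))) 0" for n
    by (auto simp: trace_def matrix_matrix_mult_def
        intro!: eq_at_0_sum_zero eq_at_0_mult_zero(2) eq_at_0_mult_zero(1) [OF assms(2)])
qed

lemma eq_at_0_mps_exp:
  assumes "eq_at_0 P f 0"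
  shows "eq_at_0 P (mps_exp f) 1"
proof (rule eq_at_0_limit)
  let ?t = "\<lambda>k. const (1 / fact k) * f ^ k"
  have "coeff f 0 = 0"
    using assms by (simp add: eq_at_0_def)
  then have "?t sums mps_exp f"
    unfolding mps_exp_def by (intro summable_sums summable_mps_exp)
  then show "(\<lambda>n. \<Sum>k<Suc n. ?t k) \<longlonglongrightarrow> mps_exp f"
    unfolding sums_def by (rule LIMSEQ_Suc)
  have "eq_at_0 P (\<Sum>k<n. ?t (Suc k)) 0" for n
    by (auto intro!: eq_at_0_sum_zero eq_at_0_mult_zero(2) eq_at_0_mult_zero(1) [OF assms])
  then show "eq_at_0 P (\<Sum>k<Suc n. ?t k) 1" for n
    using eq_at_0_add [of P 1 1] by (fastforce simp: sum.lessThan_Suc_shift simp del: sum.lessThan_Suc)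
qed


section \<open>Inserting a copy of an index\<close>

instance indet :: (finite, finite) finite
proof
  have "(UNIV :: ('a, 'b) indet set) = {Beta} \<union> (\<Union>j. range (Ent_A j)) \<union> (\<Union>j. range (Ent_B j)) \<union>
      (\<Union>j. range (Ent_U j)) \<union> (\<Union>j. range (Ent_V j))" (is "_ = ?R")
  proof (intro equalityI subsetI)
    fix x :: "('a, 'b) indet"
    show "x \<in> ?R" by (cases x) (simp_all add: image_iff)
  qed simp
  moreover have "finite ?R"
    by (intro finite_UnI finite_UN_I finite_imageI) simp_all
  ultimately show "finite (UNIV :: ('a, 'b) indet set)"
    by simp
qed

fun in_column :: "'n \<Rightarrow> ('n, 'm) indet \<Rightarrow> bool" where
  "in_column i (Ent_A j k) \<longleftrightarrow> k = i"
| "in_column i (Ent_U j k) \<longleftrightarrow> k = i"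
| "in_column i _ \<longleftrightarrow> False"

text \<open>A permutation enters every column exactly once. So in the monomials of the extended permanent of a
  block matrix, the degree in the variables of column \<open>i\<close> is the number of copies of \<open>i\<close>.\<close>

abbreviation col_deg :: "'n::finite \<Rightarrow> (('n, 'm::finite) indet \<Rightarrow>\<^sub>0 nat) \<Rightarrow> nat" where
  "col_deg i \<equiv> pdeg (in_column i)"

text \<open>As a vector field this replaces an entry \<open>M x y\<close> of the block matrix by \<open>M x i * M i y\<close>: a new copy
  of \<open>i\<close> is put on the arc from \<open>x\<close> to \<open>y\<close>.\<close>

fun insertion :: "'n \<Rightarrow> ('n, 'm) indet \<Rightarrow> ('n, 'm) indet mps" where
  "insertion i Beta = 0"
| "insertion i (Ent_A j k) = Var (Ent_A j i) * Var (Ent_A i k)"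
| "insertion i (Ent_B j k) = Var (Ent_U j i) * Var (Ent_V i k)"
| "insertion i (Ent_U j k) = Var (Ent_U j i) * Var (Ent_A i k)"
| "insertion i (Ent_V j k) = Var (Ent_A j i) * Var (Ent_V i k)"

text \<open>The new copy of \<open>i\<close> either forms a cycle of its own or is inserted into an arc.\<close>

definition add_copy :: "'n::finite \<Rightarrow> ('n, 'm::finite) indet mps \<Rightarrow> ('n, 'm) indet mps" where
  "add_copy i f = Var Beta * Var (Ent_A i i) * f + vfield (insertion i) f"

lemma homog_Var_in_column:
  "homog (in_column i) d (Var v) \<longleftrightarrow> d = (if in_column i v then 1 else 0)"
  by (auto simp: homog_def coeff_Var)

lemma homog_insertion:
  "homog (in_column j) ((if j = i then 1 else 0) + (if in_column j v then 1 else 0)) (insertion i v)"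
proof (cases v)
  case (Ent_A k l)
  then show ?thesis
    using homog_mult [OF homog_Var homog_Var, of "in_column j" "Ent_A k i" "Ent_A i l"] by (auto split: if_splits)
next
  case (Ent_B k l)
  then show ?thesis
    using homog_mult [OF homog_Var homog_Var, of "in_column j" "Ent_U k i" "Ent_V i l"] by (auto split: if_splits)
next
  case (Ent_U k l)
  then show ?thesis
    using homog_mult [OF homog_Var homog_Var, of "in_column j" "Ent_U k i" "Ent_A i l"] by (auto split: if_splits)
next
  case (Ent_V k l)
  then show ?thesis
    using homog_mult [OF homog_Var homog_Var, of "in_column j" "Ent_A k i" "Ent_V i l"] by (auto split: if_splits)
qed simp

text \<open>Adding a copy of \<open>i\<close> raises the degree in column \<open>i\<close> by one and preserves the others.\<close>

lemma coeff_add_copy_eq_0: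
  assumes "\<And>m'. (\<And>j. col_deg j m = col_deg j m' + (if j = i then 1 else 0)) \<Longrightarrow> coeff f m' = 0"
  shows "coeff (add_copy i f) m = 0"
proof -
  have "coeff (Var Beta * Var (Ent_A i i) * f) m = 0"
  proof (rule ccontr)
    assume "coeff (Var Beta * Var (Ent_A i i) * f) m \<noteq> 0"
    then obtain a b where ab: "a + b = m" "coeff (Var Beta * Var (Ent_A i i)) a \<noteq> 0" "coeff f b \<noteq> 0"
      by (rule coeff_mult_nonzeroE)
    have "col_deg j a = (if j = i then 1 else 0)" for j
      using homogD [OF homog_mult [OF homog_Var homog_Var] ab(2), of "in_column j"] by auto
    then have "coeff f b = 0"
      using ab(1) by (intro assms) auto
    with ab(3) show False by simp
  qed
  moreover have "coeff (insertion i v * pdiff v f) m = 0" for v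
  proof (rule ccontr)
    assume "coeff (insertion i v * pdiff v f) m \<noteq> 0"
    then obtain a b where ab: "a + b = m" "coeff (insertion i v) a \<noteq> 0" "coeff (pdiff v f) b \<noteq> 0"
      by (rule coeff_mult_nonzeroE)
    have "col_deg j a = (if j = i then 1 else 0) + (if in_column j v then 1 else 0)" for j
      by (rule homogD [OF homog_insertion ab(2)])
    then have "coeff f (b + Poly_Mapping.single v 1) = 0"
      using ab(1) by (intro assms) auto
    with ab(3) show False by (simp add: coeff_pdiff)
  qed
  ultimately show ?thesis
    by (simp add: add_copy_def vfield_def)
qed

lemma block_index_Suc:
  "block_index (r(i := Suc (r i))) = insert (Inr (i, Suc (r i))) (block_index r)"
  by (auto simp: block_index_def le_Suc_eq split: if_splits)

lemma finite_block_index [simp]: "finite (block_index (r :: 'n::finite \<Rightarrow> nat) :: ('m::finite + 'n \<times> nat) set)"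
  by (simp add: block_index_def)

context
  fixes \<beta> :: "('n::finite, 'm::finite) indet mps"
    and A :: "('n, 'm) indet mps ^ 'n ^ 'n"
    and B :: "('n, 'm) indet mps ^ 'm ^ 'm"
    and U :: "('n, 'm) indet mps ^ 'n ^ 'm"
    and V :: "('n, 'm) indet mps ^ 'm ^ 'n"
  assumes \<beta>: "\<beta> = Var Beta"
    and A: "A = (\<chi> i j. Var (Ent_A i j))"
    and B: "B = (\<chi> i' j'. Var (Ent_B i' j'))"
    and U: "U = (\<chi> i' j. Var (Ent_U i' j))"
    and V: "V = (\<chi> i j'. Var (Ent_V i j'))"
begin

definition block_perm :: "('n \<Rightarrow> nat) \<Rightarrow> ('n, 'm) indet mps" where
  "block_perm r = perm \<beta> (block_index r) (block_entry B U V A)"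

text \<open>Delete the new copy of \<open>i\<close> by \<open>perm_insert\<close>. If it was a fixed point, a factor \<open>\<beta> A\<^sub>i\<^sub>i\<close> splits
  off; otherwise it sat on an arc between two old indices, and the sum over all arcs is, by the Leibniz
  rule, the action of the insertion field on the smaller permanent.\<close>

lemma block_perm_Suc: "block_perm (r(i := Suc (r i))) = add_copy i (block_perm r)"
proof -
  let ?x = "Inr (i, Suc (r i)) :: 'm + 'n \<times> nat" and ?X = "block_index r" and ?M = "block_entry B U V A"
  have x: "?x \<notin> ?X"
    by (auto simp: block_index_def)
  have "vfield (insertion i) (?M y z) = ?M y ?x * ?M ?x z" for y z
    by (cases y; cases z) (auto simp: A B U V)
  then have "vfield (insertion i) (perm \<beta> ?X ?M) =
      (\<Sum>y\<in>?X. perm \<beta> ?X (?M(y := \<lambda>z. ?M y ?x * ?M ?x z)))"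
    by (simp add: vfield_perm \<beta>)
  then show ?thesis
    unfolding block_perm_def block_index_Suc perm_insert [OF finite_block_index x]
    by (simp add: add_copy_def \<beta> A)
qed

lemma block_perm_0: "block_perm (\<lambda>_. 0) = perm \<beta> UNIV (\<lambda>i' j'. B $ i' $ j')"
proof -
  have "block_index (\<lambda>_. 0) = (range Inl :: ('m + 'n \<times> nat) set)"
    by (auto simp: block_index_def)
  then show ?thesis
    by (simp add: block_perm_def perm_image)
qed

lemma homog_block_perm: "homog (in_column i) (r i) (block_perm r)"
proof -
  define d :: "'m + 'n \<times> nat \<Rightarrow> nat" where "d x = (if x \<in> Inr ` ({i} \<times> UNIV) then 1 else 0)" for x
  have "homog (in_column i) (d y) (block_entry B U V A x y)" for x y
    by (cases x; cases y) (auto simp: A B U V d_def homog_Var_in_column)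
  then have "homog (in_column i) (sum d (block_index r)) (block_perm r)"
    unfolding block_perm_def by (intro homog_perm) (auto simp: \<beta> homog_Var_in_column)
  also have "sum d (block_index r) = card (Inr ` ({i} \<times> {1..r i}) :: ('m + 'n \<times> nat) set)"
  proof -
    have "sum d (block_index r) = (\<Sum>x\<in>(Inr ` ({i} \<times> {1..r i}) :: ('m + 'n \<times> nat) set). 1)"
      by (rule sum.mono_neutral_cong_right) (auto simp: d_def block_index_def)
    then show ?thesis by simp
  qed
  also have "\<dots> = r i"
    by (simp add: card_image)
  finally show ?thesis .
qed

definition weighted_perm :: "('n \<Rightarrow> nat) \<Rightarrow> ('n, 'm) indet mps" where
  "weighted_perm r = const (1 / (\<Prod>i\<in>UNIV. fact (r i))) * block_perm r"

lemma homog_weighted_perm: "homog (in_column i) (r i) (weighted_perm r)"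
  unfolding weighted_perm_def by (rule homog_const_mult [OF homog_block_perm])

lemma coeff_add_copy_weighted_perm:
  "coeff (add_copy i (weighted_perm r)) m =
    of_nat (Suc (r i)) * coeff (weighted_perm (r(i := Suc (r i)))) m"
proof -
  let ?c = "1 / (\<Prod>j\<in>UNIV. fact (r j)) :: rat"
  have "(\<Prod>j\<in>UNIV. fact ((r(i := Suc (r i))) j)) = (of_nat (Suc (r i)) * (\<Prod>j\<in>UNIV. fact (r j)) :: rat)"
    by (simp add: prod.remove [of UNIV i] del: of_nat_Suc)
  moreover have "add_copy i (weighted_perm r) = const ?c * add_copy i (block_perm r)"
    by (simp add: add_copy_def weighted_perm_def vfield_mult algebra_simps)
  ultimately show ?thesis
    by (simp add: weighted_perm_def block_perm_Suc del: of_nat_Suc)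
qed

text \<open>If some column degree of \<open>m\<close> is positive, the Euler field of that column multiplies the
  coefficient at \<open>m\<close> by this degree, a nonzero rational. The hypothesis \<open>Euler\<close> therefore expresses the
  coefficient through coefficients of smaller column degree, and the weighted permanents satisfy the same
  recursion by \<open>coeff_add_copy_weighted_perm\<close>.\<close>

lemma coeff_eq_weighted_perm:
  assumes Euler: "\<And>i. vfield (\<lambda>v. if in_column i v then Var v else 0) G = add_copy i G"
    and start: "\<And>m. (\<And>i. col_deg i m = 0) \<Longrightarrow> coeff G m = coeff (block_perm (\<lambda>_. 0)) m"
  shows "coeff G m = coeff (weighted_perm (\<lambda>i. col_deg i m)) m"
proof (induction "\<Sum>i\<in>UNIV. col_deg i m" arbitrary: m rule: less_induct)
  case less
  show ?case
  proof (cases "\<forall>i. col_deg i m = 0")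
    case True
    then show ?thesis
      by (simp add: start weighted_perm_def)
  next
    case False
    then obtain i where i: "col_deg i m > 0" by blast
    define r where "r j = (if j = i then col_deg j m - 1 else col_deg j m)" for j
    have r_Suc: "r(i := Suc (r i)) = (\<lambda>j. col_deg j m)"
      using i by (auto simp: r_def)
    have "coeff (add_copy i (G - weighted_perm r)) m = 0"
    proof (rule coeff_add_copy_eq_0)
      fix m' :: "('n, 'm) indet \<Rightarrow>\<^sub>0 nat"
      assume m': "\<And>j. col_deg j m = col_deg j m' + (if j = i then 1 else 0)"
      have "(\<Sum>j\<in>UNIV. col_deg j m) = (\<Sum>j\<in>UNIV. col_deg j m') + 1"
        by (simp add: m' sum.distrib)
      moreover have "(\<lambda>j. col_deg j m') = r"
        using m' by (auto simp: r_def)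
      ultimately show "coeff (G - weighted_perm r) m' = 0"
        using less [of m'] by simp
    qed
    then have "coeff (add_copy i G) m = coeff (add_copy i (weighted_perm r)) m"
      by (simp add: add_copy_def vfield_diff algebra_simps)
    then have "of_nat (col_deg i m) * coeff G m =
        of_nat (Suc (r i)) * coeff (weighted_perm (\<lambda>j. col_deg j m)) m"
      by (simp only: Euler [symmetric] coeff_vfield_Euler coeff_add_copy_weighted_perm r_Suc)
    moreover have "Suc (r i) = col_deg i m"
      using i by (simp add: r_def)
    ultimately show ?thesis
      using i by simp
  qed
qed

text \<open>By homogeneity a monomial occurs in at most one summand, namely the one whose multiplicities are
  its column degrees. Hence the sum converges to the series with these coefficients.\<close>

lemma has_sum_weighted_perm:
  assumes "\<And>m. coeff G m = coeff (weighted_perm (\<lambda>i. col_deg i m)) m"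
  shows "(weighted_perm has_sum G) UNIV"
  unfolding has_sum_def tendsto_mps_iff
proof
  fix m :: "('n, 'm) indet \<Rightarrow>\<^sub>0 nat"
  let ?r = "\<lambda>i. col_deg i m"
  have "coeff (sum weighted_perm F) m = coeff G m" if "finite F" "?r \<in> F" for F
  proof -
    have "coeff (weighted_perm r) m = 0" if "r \<noteq> ?r" for r
    proof (rule ccontr)
      assume "coeff (weighted_perm r) m \<noteq> 0"
      then have "?r = r"
        using homogD [OF homog_weighted_perm] by blast
      with that show False by simp
    qed
    then have "(\<Sum>r\<in>F. coeff (weighted_perm r) m) = (\<Sum>r\<in>{?r}. coeff (weighted_perm r) m)"
      using that by (intro sum.mono_neutral_right) auto
    then show ?thesis
      by (simp add: assms)
  qed
  then show "\<forall>\<^sub>F F in finite_subsets_at_top UNIV. coeff (sum weighted_perm F) m = coeff G m"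
    unfolding eventually_finite_subsets_at_top by (intro exI [of _ "{?r}"]) auto
qed


section \<open>The action on the Schur complement and the determinant\<close>

abbreviation in_some_column :: "('n, 'm) indet \<Rightarrow> bool" where
  "in_some_column v \<equiv> \<exists>i. in_column i v"

lemma col_deg_eq_0_iff: "pdeg in_some_column m = 0 \<longleftrightarrow> (\<forall>i. col_deg i m = 0)"
  by (auto simp: pdeg_def)

lemma A_at_0: "eq_at_0 in_some_column (A $ i $ j) 0"
  using eq_at_0_Var [of in_some_column "Ent_A i j"] by (simp add: A)

lemma coeff_A_0: "coeff (A $ i $ j) 0 = 0"
  using homog_Var [of "\<lambda>_. True" "Ent_A i j"] by (auto simp: A homog_def)

context
  fixes i :: 'n
begin

text \<open>Multiplying by the degree in column \<open>i\<close> amounts to marking an occurrence of the index \<open>i\<close>, and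
  the insertion field creates such an occurrence. In the Schur complement, a sum over all walks through
  the indices of \<open>A\<close>, these are the same operation; so the difference of the two fields annihilates it.\<close>

definition defect :: "('n, 'm) indet \<Rightarrow> ('n, 'm) indet mps" where
  "defect v = (if in_column i v then Var v else 0) - insertion i v"

lemma vfield_defect:
  "vfield defect f = vfield (\<lambda>v. if in_column i v then Var v else 0) f - vfield (insertion i) f"
  by (simp add: vfield_def defect_def algebra_simps sum_subtractf)

text \<open>With the matrix unit at \<open>(i, i)\<close> the action of the defect field on \<open>A\<close>, \<open>B\<close>, \<open>U\<close> and \<open>V\<close> can be
  written with matrix products: a word with the unit in it has the index \<open>i\<close> at that place. The factor
  \<open>I - A\<close> that arises for \<open>A\<close> and \<open>U\<close> is then cancelled by the Neumann inverse.\<close>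

definition unit_at :: "('n, 'm) indet mps ^ 'n ^ 'n" where
  "unit_at = (\<chi> j k. if j = i \<and> k = i then 1 else 0)"

lemma mult_unit_at: "(X ** unit_at) $ j $ k = (if k = i then X $ j $ i else 0)"
  by (simp add: matrix_matrix_mult_def unit_at_def if_distrib [of "(*) _"] cong: if_cong)

lemma mult_unit_at_mult: "(X ** unit_at ** Y) $ j $ k = X $ j $ i * Y $ i $ k"
  unfolding matrix_matrix_mult_def [of _ Y] by (simp add: mult_unit_at if_distribR if_distrib [of "\<lambda>x. x * _"] cong: if_cong)

lemma defect_A: "matrix_vfield defect A = A ** unit_at ** (mat 1 - A)"
  and defect_U: "matrix_vfield defect U = U ** unit_at ** (mat 1 - A)"
  and defect_V: "matrix_vfield defect V = - (A ** unit_at ** V)"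
  and defect_B: "matrix_vfield defect B = - (U ** unit_at ** V)"
  unfolding vec_eq_iff matrix_diff_ldistrib
  by (auto simp: mult_unit_at mult_unit_at_mult A B U V defect_def)

lemma defect_neumann_inverse:
  "matrix_vfield defect (neumann_inverse A) = neumann_inverse A ** A ** unit_at"
proof -
  let ?R = "neumann_inverse A"
  have "matrix_vfield defect ?R = ?R ** (A ** unit_at) ** ((mat 1 - A) ** ?R)"
    by (simp only: matrix_vfield_neumann_inverse [OF coeff_A_0] defect_A matrix_mul_assoc)
  then show ?thesis
    by (simp add: neumann_inverse_right [OF coeff_A_0] matrix_mul_assoc)
qed

text \<open>With \<open>R\<close> the Neumann inverse and \<open>E\<close> the matrix unit, the product \<open>U R V\<close> contributes
  \<open>U E V + U R A E V - U R A E V\<close>, and \<open>B\<close> contributes \<open>- U E V\<close>.\<close>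

lemma defect_Schur_complement: "matrix_vfield defect (B + U ** neumann_inverse A ** V) = 0"
proof -
  let ?R = "neumann_inverse A"
  have "matrix_vfield defect (U ** ?R) = U ** unit_at ** ((mat 1 - A) ** ?R) + U ** (?R ** A ** unit_at)"
    by (simp only: matrix_vfield_mult defect_U defect_neumann_inverse matrix_mul_assoc)
  then have "matrix_vfield defect (U ** ?R) = U ** unit_at + U ** ?R ** A ** unit_at"
    by (simp add: neumann_inverse_right [OF coeff_A_0] matrix_mul_assoc)
  then show ?thesis
    by (simp add: matrix_vfield_add matrix_vfield_mult [of _ "U ** ?R"] defect_B defect_V
        matrix_add_rdistrib matrix_uminus_right matrix_mul_assoc)
qed

lemma defect_log_det_series: "vfield defect (log_det_series A) = A $ i $ i"
proof -
  let ?R = "neumann_inverse A"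
  have "trace (A ** unit_at ** (mat 1 - A) ** ?R) = trace (A ** unit_at ** ((mat 1 - A) ** ?R))"
    by (simp only: matrix_mul_assoc)
  also have "\<dots> = trace (A ** unit_at)"
    by (simp add: neumann_inverse_right [OF coeff_A_0])
  also have "\<dots> = A $ i $ i"
    by (simp add: trace_def mult_unit_at)
  finally show ?thesis
    by (simp add: vfield_log_det_series [OF coeff_A_0] defect_A)
qed

end

abbreviation (input) closed_form :: "('n, 'm) indet mps" where
  "closed_form \<equiv> perm \<beta> UNIV (\<lambda>i' j'. (B + U ** neumann_inverse A ** V) $ i' $ j') *
    mps_exp (\<beta> * log_det_series A)"

text \<open>The defect field annihilates the permanent of the Schur complement, and its value on the
  exponent of the determinant factor is \<open>\<beta> A\<^sub>i\<^sub>i\<close>. So it multiplies the product by \<open>\<beta> A\<^sub>i\<^sub>i\<close>, which is the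
  part of \<^const>\<open>add_copy\<close> that belongs to a new fixed point.\<close>

lemma Euler_closed_form:
  "vfield (\<lambda>v. if in_column i v then Var v else 0) closed_form = add_copy i closed_form"
proof -
  let ?D = "vfield (defect i)" and ?S = "B + U ** neumann_inverse A ** V"
  have "?D \<beta> = 0"
    by (simp add: \<beta> defect_def)
  have "?D (?S $ j $ k) = 0" for j k
    using defect_Schur_complement [of i] by (metis nth_map_matrix zero_index)
  have "?D (perm \<beta> UNIV (\<lambda>i' j'. ?S $ i' $ j')) = 0"
  proof -
    have "perm \<beta> UNIV ((\<lambda>i' j'. ?S $ i' $ j')(y := \<lambda>z. ?D (?S $ y $ z))) = 0" for y
    proof -
      have "(\<Prod>x\<in>UNIV. ((\<lambda>i' j'. ?S $ i' $ j')(y := \<lambda>z. ?D (?S $ y $ z))) x (p x)) = 0" for p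
        by (rule prod_zero) (use \<open>\<And>k j. ?D (?S $ j $ k) = 0\<close> in auto)
      then show ?thesis by (simp add: perm_def)
    qed
    then show ?thesis
      using \<open>?D \<beta> = 0\<close> by (simp add: vfield_perm)
  qed
  moreover have "?D (mps_exp (\<beta> * log_det_series A)) = mps_exp (\<beta> * log_det_series A) * (\<beta> * A $ i $ i)"
  proof -
    have "eq_at_0 in_some_column (log_det_series A) 0"
      by (rule eq_at_0_log_det_series [OF coeff_A_0 A_at_0])
    then have "eq_at_0 in_some_column (\<beta> * log_det_series A) 0"
      by (rule eq_at_0_mult_zero)
    then have "coeff (\<beta> * log_det_series A) 0 = 0"
      by (simp add: eq_at_0_def)
    then show ?thesis
      using \<open>?D \<beta> = 0\<close> by (simp add: vfield_mps_exp vfield_mult defect_log_det_series)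
  qed
  ultimately have "?D closed_form = \<beta> * A $ i $ i * closed_form"
    by (simp add: vfield_mult)
  then show ?thesis
    by (simp add: vfield_defect add_copy_def \<beta> A algebra_simps)
qed

text \<open>Without the variables of \<open>A\<close> and \<open>U\<close> the Schur complement reduces to \<open>B\<close> and the determinant to 1.\<close>

lemma closed_form_at_0: "eq_at_0 in_some_column closed_form (block_perm (\<lambda>_. 0))"
proof -
  have "eq_at_0 in_some_column ((B + U ** neumann_inverse A ** V) $ j $ k) (B $ j $ k)" for j k
  proof -
    have "eq_at_0 in_some_column (U $ j $ l) 0" for l
      using eq_at_0_Var [of in_some_column "Ent_U j l"] by (simp add: U)
    then have "eq_at_0 in_some_column ((U ** neumann_inverse A ** V) $ j $ k) 0"
      unfolding matrix_matrix_mult_def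
      by (auto intro!: eq_at_0_sum_zero eq_at_0_mult_zero(1))
    from eq_at_0_add [OF eq_at_0_refl [of _ "B $ j $ k"] this] show ?thesis by simp
  qed
  moreover have "eq_at_0 in_some_column (mps_exp (\<beta> * log_det_series A)) 1"
    by (intro eq_at_0_mps_exp eq_at_0_mult_zero(2) eq_at_0_log_det_series coeff_A_0 A_at_0)
  ultimately show ?thesis
    using eq_at_0_mult [OF eq_at_0_perm] by (fastforce simp: block_perm_0)
qed

lemma has_sum_perm_blocks:
  "((\<lambda>r. const (1 / (\<Prod>i\<in>UNIV. fact (r i))) * perm \<beta> (block_index r) (block_entry B U V A))
    has_sum perm \<beta> UNIV (\<lambda>i' j'. (B + U ** neumann_inverse A ** V) $ i' $ j') *
      det_id_minus_neg_power A \<beta>) UNIV"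
proof -
  have at_0: "coeff closed_form m = coeff (block_perm (\<lambda>_. 0)) m" if "\<And>i. col_deg i m = 0" for m
    using closed_form_at_0 that by (simp add: eq_at_0_def col_deg_eq_0_iff)
  have "(weighted_perm has_sum closed_form) UNIV"
    by (intro has_sum_weighted_perm coeff_eq_weighted_perm Euler_closed_form at_0)
  moreover have "weighted_perm =
      (\<lambda>r. const (1 / (\<Prod>i\<in>UNIV. fact (r i))) * perm \<beta> (block_index r) (block_entry B U V A))"
    by (simp add: fun_eq_iff weighted_perm_def block_perm_def)
  ultimately show ?thesis
    by (simp only: det_id_minus_neg_power_def log_det_series_def)
qed

end

theorem theorem3p1:
  fixes \<beta> :: "('n::finite, 'm::finite) indet mps"
    and A :: "('n, 'm) indet mps ^ 'n ^ 'n"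
    and B B' :: "('n, 'm) indet mps ^ 'm ^ 'm"
    and U :: "('n, 'm) indet mps ^ 'n ^ 'm"
    and V :: "('n, 'm) indet mps ^ 'm ^ 'n"
  assumes "\<beta> = Var Beta"
    and "A = (\<chi> i j. Var (Ent_A i j))"
    and "B = (\<chi> i' j'. Var (Ent_B i' j'))"
    and "U = (\<chi> i' j. Var (Ent_U i' j))"
    and "V = (\<chi> i j'. Var (Ent_V i j'))"
    and "B' = B + U ** neumann_inverse A ** V"
  shows "((\<lambda>r :: 'n \<Rightarrow> nat.
            const (1 / (\<Prod>i\<in>UNIV. fact (r i))) * perm \<beta> (block_index r) (block_entry B U V A))
          has_sum perm \<beta> UNIV (\<lambda>i' j'. B' $ i' $ j') * det_id_minus_neg_power A \<beta>) UNIV"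
  using has_sum_perm_blocks [OF assms(1-5)] assms(6) by simp

end
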